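(* Let $\mathbf{k}$ be a field and let $w=(1,1,1,1,1,1,1,1)$ (so $n=8$). Let $R_w$ be the graded ring of $\mathrm{SL}_2$-invariant sections of powers of $\mathcal{O}(1,\dots,1)$ on $(\mathbb{P}^1)^8$. Then $R_w$ is not Koszul.
   Context: Let $S=\mathbf{k}[x_1,y_1,\dots,x_8,y_8]$, graded by $\mathbb{N}^8$ with $\deg x_i=\deg y_i=e_i$ (the $i$-th standard basis vector), and let $S_r$ be the graded piece of degree $r$, so $S_r=H^0((\mathbb{P}^1)^8,\mathcal{O}(r_1,\dots,r_8))$. The group $\mathrm{SL}_2$ acts on $S$ through left multiplication on the $2\times 8$ matrix with columns $(x_i,y_i)^T$; invariants are taken with respect to the algebraic group (group scheme) $\mathrm{SL}_2$ (for infinite $\mathbf{k}$, the same as invariants of $\mathrm{SL}(2,\mathbf{k})$). Then $R_w=\bigoplus_{d\ge0}(S_{dw})^{\mathrm{SL}_2}$, with degree-$d$ part $(S_{dw})^{\mathrm{SL}_2}$. A graded $\mathbf{k}$-algebra $R$ is Koszul if $\mathbf{k}$ admits a linear free resolution as an $R$-module. *)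

theory Defs
  imports Complex_Main "HOL-Library.Poly_Mapping" "HOL-Library.Numeral_Type"
begin

section \<open>The ring of invariants of weighted points on the projective line\<close>

text \<open>
  Polynomials over \<open>'a\<close> in variables indexed by \<open>'v\<close> are finitely supported maps from
  monomials to coefficients, with the convolution product of \<^theory>\<open>HOL-Library.Poly_Mapping\<close>.
\<close>

type_synonym ('v, 'a) mpoly = "('v \<Rightarrow>\<^sub>0 nat) \<Rightarrow>\<^sub>0 'a"

definition Const :: "'a::comm_ring_1 \<Rightarrow> ('v, 'a) mpoly" where
  "Const c = Poly_Mapping.single 0 c"

definition Var :: "'v \<Rightarrow> ('v, 'a::comm_ring_1) mpoly" where
  "Var v = Poly_Mapping.single (Poly_Mapping.single v 1) 1"

definition subst :: "('a::comm_ring_1 \<Rightarrow> 'r::comm_ring_1) \<Rightarrow> ('v \<Rightarrow> 'r) \<Rightarrow> ('v, 'a) mpoly \<Rightarrow> 'r" where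
  "subst \<iota> \<sigma> f =
     (\<Sum>m\<in>Poly_Mapping.keys f. \<iota> (Poly_Mapping.lookup f m) *
        (\<Prod>v\<in>Poly_Mapping.keys m. \<sigma> v ^ Poly_Mapping.lookup m v))"

datatype 'n coord = X 'n | Y 'n

definition multigraded_piece :: "('n \<Rightarrow> nat) \<Rightarrow> ('n coord, 'k::field) mpoly set" where
  "multigraded_piece r =
     {f. \<forall>m\<in>Poly_Mapping.keys f. \<forall>i.
           Poly_Mapping.lookup m (X i) + Poly_Mapping.lookup m (Y i) = r i}"

text \<open>
  The generic \<open>2 \<times> 2\<close> matrix has rows \<open>(a, b)\<close> and \<open>(c, d)\<close>, with entries in \<open>S[a,b,c,d]\<close>.  Left
  multiplication by it on the columns \<open>(x\<^sub>i, y\<^sub>i)\<close> gives the coaction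
  \<open>S \<rightarrow> S[a,b,c,d]/(ad - bc - 1) = S \<otimes> k[SL\<^sub>2]\<close>.
  An element is invariant under the group scheme when the coaction sends it to \<open>f \<otimes> 1\<close>; this is
  the right notion over every field, including finite ones.
\<close>

datatype mat_entry = a_entry | b_entry | c_entry | d_entry

fun generic_action :: "'n coord \<Rightarrow> (mat_entry, ('n coord, 'k::field) mpoly) mpoly" where
  "generic_action (X i) = Var a_entry * Const (Var (X i)) + Var b_entry * Const (Var (Y i))"
| "generic_action (Y i) = Var c_entry * Const (Var (X i)) + Var d_entry * Const (Var (Y i))"

definition coaction ::
    "('n coord, 'k::field) mpoly \<Rightarrow> (mat_entry, ('n coord, 'k) mpoly) mpoly" where
  "coaction = subst (\<lambda>c. Const (Const c)) generic_action"

definition SL2_invariant :: "('n coord, 'k::field) mpoly \<Rightarrow> bool" where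
  "SL2_invariant f \<longleftrightarrow>
     (Var a_entry * Var d_entry - Var b_entry * Var c_entry - 1) dvd (coaction f - Const f)"

definition invariant_ring :: "('n \<Rightarrow> nat) \<Rightarrow> nat \<Rightarrow> ('n coord, 'k::field) mpoly set" where
  "invariant_ring w d = {f \<in> multigraded_piece (\<lambda>i. d * w i). SL2_invariant f}"


section \<open>Koszul algebras\<close>

text \<open>
  A graded ring or module is given by its family of homogeneous components inside an ambient
  additive group.  Below, \<open>R\<close> is a connected graded commutative algebra, so that the ground field
  is its component \<open>R 0\<close>.
\<close>

definition direct_sum :: "(nat \<Rightarrow> 'm::ab_group_add set) \<Rightarrow> 'm set" where
  "direct_sum M = {\<Sum>d\<in>D. u d | D u. finite D \<and> (\<forall>d\<in>D. u d \<in> M d)}"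

definition graded_hom ::
    "(nat \<Rightarrow> 'a::comm_ring_1 set) \<Rightarrow>
     ('a \<Rightarrow> 'm \<Rightarrow> 'm) \<Rightarrow> (nat \<Rightarrow> 'm::ab_group_add set) \<Rightarrow>
     ('a \<Rightarrow> 'p \<Rightarrow> 'p) \<Rightarrow> (nat \<Rightarrow> 'p::ab_group_add set) \<Rightarrow> ('m \<Rightarrow> 'p) \<Rightarrow> bool" where
  "graded_hom R sM M sN N \<phi> \<longleftrightarrow>
     (\<forall>u\<in>direct_sum M. \<forall>v\<in>direct_sum M. \<phi> (u + v) = \<phi> u + \<phi> v) \<and>
     (\<forall>r\<in>direct_sum R. \<forall>u\<in>direct_sum M. \<phi> (sM r u) = sN r (\<phi> u)) \<and>
     (\<forall>d. \<phi> ` M d \<subseteq> N d)"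

text \<open>
  The graded free module \<open>R(-i)\<^sup>(\<^sup>B\<^sup>)\<close>, with basis \<open>B\<close> (of any cardinality) in degree \<open>i\<close>.
\<close>

definition free_module :: "(nat \<Rightarrow> 'a::comm_ring_1 set) \<Rightarrow> nat \<Rightarrow> 'b set \<Rightarrow> nat \<Rightarrow> ('b \<Rightarrow>\<^sub>0 'a) set" where
  "free_module R i B d =
     {u. Poly_Mapping.keys u \<subseteq> B \<and>
         (\<forall>b. Poly_Mapping.lookup u b \<in> (if i \<le> d then R (d - i) else {0}))}"

definition free_scale :: "'a::comm_ring_1 \<Rightarrow> ('b \<Rightarrow>\<^sub>0 'a) \<Rightarrow> ('b \<Rightarrow>\<^sub>0 'a)" where
  "free_scale r u = Poly_Mapping.map ((*) r) u"

text \<open>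
  The residue field \<open>k = R/R\<^sub>+\<close>, realised as \<open>R 0\<close> in degree 0, on which \<open>r\<close> acts through its
  component of degree 0.
\<close>

definition residue_module :: "(nat \<Rightarrow> 'a::comm_ring_1 set) \<Rightarrow> nat \<Rightarrow> 'a set" where
  "residue_module R d = (if d = 0 then R 0 else {0})"

definition augmentation :: "(nat \<Rightarrow> 'a::comm_ring_1 set) \<Rightarrow> 'a \<Rightarrow> 'a" where
  "augmentation R r = (THE c. c \<in> R 0 \<and> r - c \<in> direct_sum (\<lambda>d. if d = 0 then {0} else R d))"

definition residue_scale :: "(nat \<Rightarrow> 'a::comm_ring_1 set) \<Rightarrow> 'a \<Rightarrow> 'a \<Rightarrow> 'a" where
  "residue_scale R r c = augmentation R r * c"

text \<open>
  An exact complex \<open>\<dots> \<rightarrow> F\<^sub>2 \<rightarrow> F\<^sub>1 \<rightarrow> F\<^sub>0 \<rightarrow> k \<rightarrow> 0\<close> of graded modules and degree-preserving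
  homomorphisms, with \<open>F\<^sub>i = R(-i)\<^sup>(\<^sup>B\<^sup>i\<^sup>)\<close>, where \<open>\<phi> i : F\<^sub>i\<^sub>+\<^sub>1 \<rightarrow> F\<^sub>i\<close>.
\<close>

definition linear_free_resolution ::
    "(nat \<Rightarrow> 'a::comm_ring_1 set) \<Rightarrow> (nat \<Rightarrow> 'b set) \<Rightarrow>
     (('b \<Rightarrow>\<^sub>0 'a) \<Rightarrow> 'a) \<Rightarrow> (nat \<Rightarrow> ('b \<Rightarrow>\<^sub>0 'a) \<Rightarrow> ('b \<Rightarrow>\<^sub>0 'a)) \<Rightarrow> bool" where
  "linear_free_resolution R B \<epsilon> \<phi> \<longleftrightarrow>
     (let F = (\<lambda>i. free_module R i (B i)) in
      graded_hom R free_scale (F 0) (residue_scale R) (residue_module R) \<epsilon> \<and>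
      (\<forall>i. graded_hom R free_scale (F (Suc i)) free_scale (F i) (\<phi> i)) \<and>
      \<epsilon> ` direct_sum (F 0) = direct_sum (residue_module R) \<and>
      \<phi> 0 ` direct_sum (F 1) = {u \<in> direct_sum (F 0). \<epsilon> u = 0} \<and>
      (\<forall>i. \<phi> (Suc i) ` direct_sum (F (Suc (Suc i))) = {u \<in> direct_sum (F (Suc i)). \<phi> i u = 0}))"

text \<open>
  HOL cannot quantify over the type \<open>'b\<close> that bases are drawn from inside a formula, so it is a
  parameter.  A negative statement for a type variable \<open>'b\<close> excludes linear free resolutions with
  arbitrary bases.
\<close>

definition koszul :: "'b itself \<Rightarrow> (nat \<Rightarrow> 'a::comm_ring_1 set) \<Rightarrow> bool" where
  "koszul T R \<longleftrightarrow> (\<exists>(B :: nat \<Rightarrow> 'b set) \<epsilon> \<phi>. linear_free_resolution R B \<epsilon> \<phi>)"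

end

theory Submission
  imports Defs
begin

text \<open>
  In a linear free resolution \<open>F\<^sub>i = R(-i)\<^sup>(\<^sup>B\<^sup>i\<^sup>)\<close> the ranks \<open>p\<^sub>i\<close> are determined by the Hilbert function \<open>H\<close>
  of \<open>R\<close>: exactness in degree \<open>d > 0\<close> gives \<open>\<Sum>\<^sub>i (-1)\<^sup>i p\<^sub>i H(d - i) = 0\<close>.  For eight points
  \<open>H = 1, 14, 91, 364, 1085, 2666, 5719, 11096, \<dots>\<close>, and the recursion yields \<open>p\<^sub>7 = - 62320 < 0\<close>.

  Over every field \<open>H(d)\<close> counts ballot paths.  For the lower bound, each ballot path is the
  leading monomial of a product of brackets \<open>x\<^sub>i y\<^sub>j - x\<^sub>j y\<^sub>i\<close>.  For the upper bound, a nonzero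
  invariant \<open>f\<close> contains a ballot monomial: choosing the largest possible power of \<open>x\<^sub>i\<close> for one index
  after the other leaves a coefficient that is still invariant under \<open>x \<mapsto> x - y\<close>, and such a
  polynomial, if bihomogeneous, has degree in the \<open>y\<^sub>i\<close> at least its degree in the \<open>x\<^sub>i\<close>.
\<close>

text \<open>The field is arbitrary, so \<open>H\<close> cannot be computed by complete reducibility;
  the two bounds by ballot paths take its place. The upper bound tests invariance on only two
  specializations of the generic matrix: a single shear, and a torus with an indeterminate entry,
  which a finite field can supply only because invariance refers to the group scheme. An extracted
  coefficient need not be torus invariant, so the induction runs over bihomogeneous shear-invariant
  polynomials of unequal degrees \<open>p\<close> and \<open>q\<close>, and \<open>q - p\<close> is
  the current height of the path. Linearity of the resolution enters through the vanishing of
  \<open>F\<^sub>i\<close> in degrees below \<open>i\<close>: it stops the alternating sum at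
  \<open>i = d\<close> and forces one new rank per degree. Bases may have any cardinality, so
  finiteness has to be derived before anything is counted. The forced ranks are the coefficients of
  \<open>1 / H(-t)\<close>, where \<open>H(t)\<close> is the Hilbert series; degree seven is the
  first in which one is negative.\<close>

abbreviation "lookup \<equiv> Poly_Mapping.lookup"
abbreviation "keys \<equiv> Poly_Mapping.keys"
abbreviation "single \<equiv> Poly_Mapping.single"

section \<open>Substitution\<close>

lemma sum_single_keys: "(\<Sum>m\<in>keys f. single m (lookup f m)) = f"
proof (rule poly_mapping_eqI)
  fix k
  have "lookup (\<Sum>m\<in>keys f. single m (lookup f m)) k = (\<Sum>m\<in>keys f. if m = k then lookup f m else 0)"
    by (simp add: lookup_sum lookup_single when_def)
  then show "lookup (\<Sum>m\<in>keys f. single m (lookup f m)) k = lookup f k"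
    by (auto simp: in_keys_iff)
qed

lemma poly_mapping_additive_induct [case_names single add]:
  fixes f :: "'a \<Rightarrow>\<^sub>0 'b::comm_monoid_add"
  assumes single: "\<And>m c. P (single m c)" and add: "\<And>f g. P f \<Longrightarrow> P g \<Longrightarrow> P (f + g)"
  shows "P f"
proof -
  have "P (\<Sum>m\<in>A. single m (lookup f m))" if "finite A" for A
    using that by (induction A) (use single[of undefined 0] single add in auto)
  from this[of "keys f"] show ?thesis
    by (simp add: sum_single_keys)
qed

definition ring_hom :: "('a::comm_ring_1 \<Rightarrow> 'b::comm_ring_1) \<Rightarrow> bool" where
  "ring_hom h \<longleftrightarrow> h 1 = 1 \<and> (\<forall>x y. h (x + y) = h x + h y) \<and> (\<forall>x y. h (x * y) = h x * h y)"

lemma ring_homD: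
  assumes "ring_hom h"
  shows "h 1 = 1" "h (x + y) = h x + h y" "h (x * y) = h x * h y"
    "h 0 = 0" "h (- x) = - h x" "h (x - y) = h x - h y" "h (x ^ n) = h x ^ n"
    "h (sum f A) = (\<Sum>a\<in>A. h (f a))" "h (prod f A) = (\<Prod>a\<in>A. h (f a))"
proof -
  show one: "h 1 = 1" and add: "h (x + y) = h x + h y" and mult: "h (x * y) = h x * h y" for x y
    using assms by (auto simp: ring_hom_def)
  show zero: "h 0 = 0" using add[of 0 0] by simp
  show uminus: "h (- x) = - h x" for x using add[of x "- x"] zero by (simp add: eq_neg_iff_add_eq_0 add.commute)
  show "h (x - y) = h x - h y" using add[of x "- y"] uminus by simp
  show "h (x ^ n) = h x ^ n" by (induction n) (simp_all add: one mult)
  show "h (sum f A) = (\<Sum>a\<in>A. h (f a))"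
    by (induction A rule: infinite_finite_induct) (simp_all add: zero add)
  show "h (prod f A) = (\<Prod>a\<in>A. h (f a))"
    by (induction A rule: infinite_finite_induct) (simp_all add: one mult)
qed

lemma ring_hom_id: "ring_hom (\<lambda>x. x)"
  by (simp add: ring_hom_def)

lemma ring_hom_comp: "ring_hom g \<Longrightarrow> ring_hom h \<Longrightarrow> ring_hom (\<lambda>x. g (h x))"
  by (simp add: ring_hom_def)

lemma ring_hom_single_0: "ring_hom (single (0::'m::comm_monoid_add))"
  by (simp add: ring_hom_def single_add mult_single)

lemma ring_hom_Const: "ring_hom Const"
  by (simp add: ring_hom_def Const_def single_add mult_single)

definition eval_monomial :: "('v \<Rightarrow> 'r::comm_ring_1) \<Rightarrow> ('v \<Rightarrow>\<^sub>0 nat) \<Rightarrow> 'r" where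
  "eval_monomial \<sigma> m = (\<Prod>v\<in>keys m. \<sigma> v ^ lookup m v)"

lemma eval_monomial_superset:
  "finite A \<Longrightarrow> keys m \<subseteq> A \<Longrightarrow> eval_monomial \<sigma> m = (\<Prod>v\<in>A. \<sigma> v ^ lookup m v)"
  unfolding eval_monomial_def by (rule prod.mono_neutral_left) (auto simp: in_keys_iff)

lemma eval_monomial_0 [simp]: "eval_monomial \<sigma> 0 = 1"
  by (simp add: eval_monomial_def)

lemma eval_monomial_single [simp]: "eval_monomial \<sigma> (single v n) = \<sigma> v ^ n"
  by (simp add: eval_monomial_def)

lemma eval_monomial_add: "eval_monomial \<sigma> (m + n) = eval_monomial \<sigma> m * eval_monomial \<sigma> n"
proof -
  have fin: "finite (keys m \<union> keys n)" by simp
  have "keys (m + n) \<subseteq> keys m \<union> keys n" by (rule keys_add)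
  then show ?thesis
    by (simp add: eval_monomial_superset[OF fin] lookup_add power_add prod.distrib)
qed

lemma eval_monomial_Var: "eval_monomial Var m = single m 1"
proof -
  have pow: "Var v ^ n = single (single v n) 1" for v :: 'a and n
    by (induction n) (simp_all add: Var_def mult_single single_add[symmetric])
  have "(\<Prod>v\<in>A. single (single v (lookup m v)) (1::'b)) = single (\<Sum>v\<in>A. single v (lookup m v)) 1"
    if "finite A" for A
    using that by (induction A) (simp_all add: mult_single)
  then show ?thesis
    by (simp add: eval_monomial_def pow sum_single_keys)
qed

lemma subst_eval_monomial: "subst \<iota> \<sigma> f = (\<Sum>m\<in>keys f. \<iota> (lookup f m) * eval_monomial \<sigma> m)"
  by (simp add: subst_def eval_monomial_def)

context
  fixes \<iota> :: "'a::comm_ring_1 \<Rightarrow> 'r::comm_ring_1"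
  assumes \<iota>: "ring_hom \<iota>"
begin

lemma subst_superset:
  assumes "finite A" "keys f \<subseteq> A"
  shows "subst \<iota> \<sigma> f = (\<Sum>m\<in>A. \<iota> (lookup f m) * eval_monomial \<sigma> m)"
  unfolding subst_eval_monomial
  by (rule sum.mono_neutral_left) (use assms in \<open>auto simp: in_keys_iff ring_homD[OF \<iota>]\<close>)

lemma subst_add: "subst \<iota> \<sigma> (f + g) = subst \<iota> \<sigma> f + subst \<iota> \<sigma> g"
proof -
  have fin: "finite (keys f \<union> keys g)" by simp
  have "keys (f + g) \<subseteq> keys f \<union> keys g" by (rule keys_add)
  then show ?thesis
    by (simp add: subst_superset[OF fin] lookup_add ring_homD[OF \<iota>] distrib_right sum.distrib)
qed

lemma subst_single: "subst \<iota> \<sigma> (single m c) = \<iota> c * eval_monomial \<sigma> m"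
  by (simp add: subst_superset[of "{m}"])

lemma subst_Const: "subst \<iota> \<sigma> (Const c) = \<iota> c"
  by (simp add: Const_def subst_single)

lemma subst_Var: "subst \<iota> \<sigma> (Var v) = \<sigma> v"
  by (simp add: Var_def subst_single ring_homD[OF \<iota>])

lemma ring_hom_subst: "ring_hom (subst \<iota> \<sigma>)"
proof -
  have "subst \<iota> \<sigma> (single m c * g) = subst \<iota> \<sigma> (single m c) * subst \<iota> \<sigma> g" for m c g
    by (induction g rule: poly_mapping_additive_induct)
      (simp_all add: mult_single subst_single ring_homD[OF \<iota>] eval_monomial_add distrib_left subst_add)
  then have "subst \<iota> \<sigma> (f * g) = subst \<iota> \<sigma> f * subst \<iota> \<sigma> g" for f g
    by (induction f rule: poly_mapping_additive_induct) (simp_all add: distrib_right subst_add)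
  moreover have "subst \<iota> \<sigma> 1 = 1"
    using subst_single[of \<sigma> 0 1] by (simp add: ring_homD[OF \<iota>])
  ultimately show ?thesis
    by (simp add: ring_hom_def subst_add)
qed

lemma hom_subst:
  assumes "ring_hom h"
  shows "h (subst \<iota> \<sigma> f) = subst (\<lambda>c. h (\<iota> c)) (\<lambda>v. h (\<sigma> v)) f"
  by (simp add: subst_eval_monomial eval_monomial_def ring_homD[OF assms])

end

lemma subst_Const_Var: "subst Const Var f = f"
proof (induction f rule: poly_mapping_additive_induct)
  case (single m c)
  show ?case
    unfolding subst_single[OF ring_hom_Const] eval_monomial_Var by (simp add: Const_def mult_single)
qed (simp add: subst_add[OF ring_hom_Const])

lemma subst_subst:
  "subst Const \<rho> (subst Const \<sigma> f) = subst Const (\<lambda>v. subst Const \<rho> (\<sigma> v)) f"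
  by (simp add: hom_subst[OF ring_hom_Const ring_hom_subst[OF ring_hom_Const]] subst_Const[OF ring_hom_Const])

section \<open>Multiplication and division by a monomial\<close>

lemma lookup_single_times:
  fixes f :: "'m::cancel_comm_monoid_add \<Rightarrow>\<^sub>0 'a::comm_ring_1"
  shows "lookup (single u c * f) (u + k) = c * lookup f k"
  by (induction f rule: poly_mapping_additive_induct)
    (auto simp: mult_single lookup_single when_def distrib_left lookup_add)

lemma lookup_Const_times: "lookup (Const c * f) m = c * lookup f m"
  using lookup_single_times[of 0 c f m] by (simp add: Const_def)

lemma keys_single_times:
  fixes f :: "'m::cancel_comm_monoid_add \<Rightarrow>\<^sub>0 'a::comm_ring_1"
  assumes "m \<in> keys (single u c * f)"
  obtains k where "k \<in> keys f" "m = u + k"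
  using assms keys_mult[of "single u c" f] by (auto split: if_splits)

lemma exists_monomial_quotient:
  fixes f :: "('v, 'a::comm_ring_1) mpoly"
  assumes "\<And>m. m \<in> keys f \<Longrightarrow> \<exists>m'. m = u + m'"
  shows "\<exists>g. f = single u 1 * g"
proof -
  from assms obtain q where q: "\<And>m. m \<in> keys f \<Longrightarrow> m = u + q m" by metis
  have "f = (\<Sum>m\<in>keys f. single (u + q m) (lookup f m))"
    using q sum_single_keys[of f] by (metis (no_types, lifting) sum.cong)
  also have "\<dots> = single u 1 * (\<Sum>m\<in>keys f. single (q m) (lookup f m))"
    by (simp add: sum_distrib_left mult_single)
  finally show ?thesis by blast
qed

section \<open>Invariants have ballot monomials\<close>

abbreviation xdeg :: "('n::finite coord \<Rightarrow>\<^sub>0 nat) \<Rightarrow> nat" where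
  "xdeg m \<equiv> \<Sum>i\<in>UNIV. lookup m (X i)"

abbreviation ydeg :: "('n::finite coord \<Rightarrow>\<^sub>0 nat) \<Rightarrow> nat" where
  "ydeg m \<equiv> \<Sum>i\<in>UNIV. lookup m (Y i)"

lemma UNIV_coord: "(UNIV :: 'n coord set) = range X \<union> range Y"
proof (rule set_eqI)
  fix v :: "'n coord"
  show "v \<in> UNIV \<longleftrightarrow> v \<in> range X \<union> range Y" by (cases v) auto
qed

lemma eval_monomial_coord:
  fixes m :: "'n::finite coord \<Rightarrow>\<^sub>0 nat"
  shows "eval_monomial \<sigma> m = (\<Prod>i\<in>UNIV. \<sigma> (X i) ^ lookup m (X i)) * (\<Prod>i\<in>UNIV. \<sigma> (Y i) ^ lookup m (Y i))"
proof -
  have "eval_monomial \<sigma> m = (\<Prod>v\<in>range X \<union> range Y. \<sigma> v ^ lookup m v)"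
    by (intro eval_monomial_superset) (simp, simp flip: UNIV_coord)
  also have "\<dots> = (\<Prod>v\<in>range X. \<sigma> v ^ lookup m v) * (\<Prod>v\<in>range Y. \<sigma> v ^ lookup m v)"
    by (intro prod.union_disjoint) auto
  also have "\<dots> = (\<Prod>i\<in>UNIV. \<sigma> (X i) ^ lookup m (X i)) * (\<Prod>i\<in>UNIV. \<sigma> (Y i) ^ lookup m (Y i))"
    by (simp add: prod.reindex inj_on_def)
  finally show ?thesis .
qed

lemma coord_monomial_eqI:
  fixes m :: "'n coord \<Rightarrow>\<^sub>0 nat"
  assumes "\<And>i. lookup m (X i) = lookup m' (X i)" "\<And>i. lookup m (Y i) = lookup m' (Y i)"
  shows "m = m'"
proof (rule poly_mapping_eqI)
  fix k show "lookup m k = lookup m' k" using assms by (cases k) auto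
qed

text \<open>The generic matrix may be specialized to any matrix of determinant one over a
  commutative ring that receives \<open>S\<close> through \<open>j\<close>, because the multiple of
  \<open>ad - bc - 1\<close> then vanishes. Letting the ring vary provides a torus even over a
  finite field.\<close>

lemma SL2_invariant_subst:
  fixes f :: "('n coord, 'k::field) mpoly" and j :: "('n coord, 'k) mpoly \<Rightarrow> 'r::comm_ring_1"
  assumes f: "SL2_invariant f" and j: "ring_hom j" and det: "a * d - b * c = 1"
  shows "subst (\<lambda>c. j (Const c))
    (\<lambda>v. case v of X i \<Rightarrow> a * j (Var (X i)) + b * j (Var (Y i)) | Y i \<Rightarrow> c * j (Var (X i)) + d * j (Var (Y i))) f = j f"
proof -
  define e where "e = (\<lambda>v. case v of a_entry \<Rightarrow> a | b_entry \<Rightarrow> b | c_entry \<Rightarrow> c | d_entry \<Rightarrow> d)"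
  have e: "e a_entry = a" "e b_entry = b" "e c_entry = c" "e d_entry = d"
    by (simp_all add: e_def)
  have h: "ring_hom (subst j e)" by (rule ring_hom_subst[OF j])
  from f obtain q where "coaction f - Const f = (Var a_entry * Var d_entry - Var b_entry * Var c_entry - 1) * q"
    by (auto simp: SL2_invariant_def)
  then have "subst j e (coaction f - Const f) = 0"
    by (simp add: ring_homD[OF h] subst_Var[OF j] e det)
  then have "subst j e (coaction f) = j f"
    by (simp add: ring_homD[OF h] subst_Const[OF j])
  moreover have "subst j e (coaction f) = subst (\<lambda>c. j (Const c)) (\<lambda>v. subst j e (generic_action v)) f"
    unfolding coaction_def
    by (subst hom_subst[OF ring_hom_comp[OF ring_hom_Const ring_hom_Const] h]) (simp add: subst_Const[OF j])
  moreover have "(\<lambda>v. subst j e (generic_action v)) =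
    (\<lambda>v. case v of X i \<Rightarrow> a * j (Var (X i)) + b * j (Var (Y i)) | Y i \<Rightarrow> c * j (Var (X i)) + d * j (Var (Y i)))"
  proof
    fix v show "subst j e (generic_action v) =
      (case v of X i \<Rightarrow> a * j (Var (X i)) + b * j (Var (Y i)) | Y i \<Rightarrow> c * j (Var (X i)) + d * j (Var (Y i)))"
      by (cases v) (simp_all add: ring_homD[OF h] subst_Var[OF j] subst_Const[OF j] e)
  qed
  ultimately show ?thesis by simp
qed

definition shear :: "('n coord, 'k::field) mpoly \<Rightarrow> ('n coord, 'k) mpoly" where
  "shear = subst Const (\<lambda>v. case v of X i \<Rightarrow> Var (X i) - Var (Y i) | Y i \<Rightarrow> Var (Y i))"

lemma SL2_invariant_shear:
  assumes "SL2_invariant f"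
  shows "shear f = f"
  \<comment> \<open>The arguments instantiate \<open>a\<close>, \<open>d\<close>, \<open>b\<close>,
    \<open>c\<close> in this order: the matrix has rows (1, -1) and (0, 1).\<close>
  using SL2_invariant_subst[OF assms ring_hom_id, of 1 1 "-1" 0]
  by (simp add: shear_def cong: coord.case_cong)

text \<open>The torus acts through Laurent polynomials in one variable, realised as the group ring of \<open>\<int>\<close>.\<close>

lemma SL2_invariant_xdeg_eq_ydeg:
  fixes f :: "('n::finite coord, 'k::field) mpoly"
  assumes "SL2_invariant f" "m \<in> keys f"
  shows "xdeg m = ydeg m"
proof (rule ccontr)
  assume neq: "xdeg m \<noteq> ydeg m"
  define \<sigma> :: "'n coord \<Rightarrow> int \<Rightarrow>\<^sub>0 ('n coord, 'k) mpoly" where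
    "\<sigma> = (\<lambda>v. case v of X i \<Rightarrow> single 1 (Var (X i)) | Y i \<Rightarrow> single (-1) (Var (Y i)))"
  have hom: "ring_hom (\<lambda>c. single (0::int) (Const c :: ('n coord, 'k) mpoly))"
    by (rule ring_hom_comp[OF ring_hom_single_0 ring_hom_Const])
  have "subst (\<lambda>c. single 0 (Const c)) \<sigma> f = single 0 f"
    using SL2_invariant_subst[OF assms(1) ring_hom_single_0, of "single (1::int) 1" "single (-1) 1" 0 0]
    by (simp add: mult_single \<sigma>_def cong: coord.case_cong)
  moreover have pow: "single z x ^ n = single (int n * z) (x ^ n)" for z n and x :: "('n coord, 'k) mpoly"
    by (induction n) (simp_all add: mult_single algebra_simps)
  have pr: "(\<Prod>i\<in>A. single (z i) (x i)) = single (\<Sum>i\<in>A. z i) (\<Prod>i\<in>A. x i)"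
    if "finite A" for A :: "'n set" and z :: "'n \<Rightarrow> int" and x :: "'n \<Rightarrow> ('n coord, 'k) mpoly"
    using that by (induction A) (simp_all add: mult_single)
  have "eval_monomial \<sigma> k = single (int (xdeg k) - int (ydeg k)) (single k 1)" for k
    unfolding eval_monomial_Var[symmetric]
    by (simp add: eval_monomial_coord \<sigma>_def pow pr mult_single sum_negf)
  ultimately have "single 0 f = (\<Sum>k\<in>keys f. single (int (xdeg k) - int (ydeg k)) (single k (lookup f k)))"
    by (simp add: subst_eval_monomial mult_single Const_def)
  \<comment> \<open>Each monomial \<open>k\<close> sits at the Laurent exponent
    \<open>xdeg k - ydeg k\<close>. Comparing coefficients of \<open>m\<close> at its own exponent
    leaves only \<open>k = m\<close> on the right, while the left side lives at exponent
    zero.\<close>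
  then have "lookup (lookup (single 0 f) (int (xdeg m) - int (ydeg m))) m =
    (\<Sum>k\<in>keys f. lookup (lookup (single (int (xdeg k) - int (ydeg k)) (single k (lookup f k))) (int (xdeg m) - int (ydeg m))) m)"
    by (simp add: lookup_sum)
  also have "\<dots> = (\<Sum>k\<in>keys f. if k = m then lookup f m else 0)"
    by (rule sum.cong) (auto simp: lookup_single when_def)
  also have "\<dots> = lookup f m"
    using assms(2) by simp
  finally have "lookup (lookup (single 0 f) (int (xdeg m) - int (ydeg m))) m \<noteq> 0"
    using assms(2) by (simp add: in_keys_iff)
  moreover have "int (xdeg m) - int (ydeg m) \<noteq> 0"
    using neq by linarith
  ultimately show False
    by (simp add: lookup_single when_def del: of_nat_sum)
qed

section \<open>The bidegree inequality for shear-invariant polynomials\<close>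

lemma prod_graded:
  fixes G :: "nat \<Rightarrow> 'r::comm_ring_1 set"
  assumes one: "1 \<in> G 0" and mult: "\<And>a b x y. x \<in> G a \<Longrightarrow> y \<in> G b \<Longrightarrow> x * y \<in> G (a + b)"
    and f: "\<And>i. i \<in> A \<Longrightarrow> f i \<in> G e"
  shows "(\<Prod>i\<in>A. f i ^ n i) \<in> G (\<Sum>i\<in>A. n i * e)"
proof -
  have "x ^ k \<in> G (k * e)" if "x \<in> G e" for x k
    by (induction k) (auto simp: one intro: mult that)
  then show ?thesis
    using f by (induction A rule: infinite_finite_induct) (auto simp: one intro!: mult)
qed

lemma keys_subst:
  assumes "k \<in> keys (subst Const \<sigma> f)"
  obtains m where "m \<in> keys f" "k \<in> keys (eval_monomial \<sigma> m)"
proof -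
  obtain m where m: "m \<in> keys f" "k \<in> keys (Const (lookup f m) * eval_monomial \<sigma> m)"
    using assms keys_sum[of "\<lambda>m. Const (lookup f m) * eval_monomial \<sigma> m" "keys f"]
    unfolding subst_eval_monomial by blast
  then have "k \<in> keys (eval_monomial \<sigma> m)"
    by (metis in_keys_iff lookup_Const_times mult_zero_right)
  with m(1) show thesis by (rule that)
qed

text \<open>
  Substituting \<open>(y, x + y)\<close> for \<open>(x, y)\<close> in \<open>f(x - y, y) = f(x, y)\<close> gives
  \<open>f(- x, x + y) = f(y, x + y)\<close>.  The left side has \<open>x\<close>-order at least \<open>p\<close>, the right
  side has \<open>x\<close>-degree at most \<open>q\<close>.
\<close>

lemma shear_invariant_bidegree_le:
  fixes f :: "('n::finite coord, 'k::field) mpoly"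
  assumes inv: "shear f = f" and "f \<noteq> 0"
    and bideg: "\<And>m. m \<in> keys f \<Longrightarrow> xdeg m = p \<and> ydeg m = q"
  shows "p \<le> q"
proof -
  define \<rho> :: "'n coord \<Rightarrow> ('n coord, 'k) mpoly" where
    "\<rho> = (\<lambda>v. case v of X i \<Rightarrow> Var (Y i) | Y i \<Rightarrow> Var (X i) + Var (Y i))"
  define \<rho>' :: "'n coord \<Rightarrow> ('n coord, 'k) mpoly" where
    "\<rho>' = (\<lambda>v. case v of X i \<Rightarrow> - Var (X i) | Y i \<Rightarrow> Var (X i) + Var (Y i))"
  \<comment> \<open>\<open>\<nu>\<close> undoes \<open>\<rho>\<close>: it recovers
    \<open>(x, y)\<close> from \<open>(y, x + y)\<close>. Hence \<open>subst Const \<rho> f\<close>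
    is nonzero and contains a monomial \<open>k\<close>, to which both bounds on the x-degree
    apply.\<close>
  define \<nu> :: "'n coord \<Rightarrow> ('n coord, 'k) mpoly" where
    "\<nu> = (\<lambda>v. case v of X i \<Rightarrow> Var (Y i) - Var (X i) | Y i \<Rightarrow> Var (X i))"
  note hom = ring_homD[OF ring_hom_subst[OF ring_hom_Const]] subst_Var[OF ring_hom_Const]
  have "subst Const \<rho> (shear f) = subst Const \<rho>' f"
    unfolding shear_def subst_subst
    by (rule arg_cong[of _ _ "\<lambda>\<sigma>. subst Const \<sigma> f"])
      (auto simp: fun_eq_iff \<rho>_def \<rho>'_def hom split: coord.split)
  then have eq: "subst Const \<rho> f = subst Const \<rho>' f" by (simp add: inv)
  have "(\<lambda>v. subst Const \<nu> (\<rho> v)) = Var"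
    by (auto simp: fun_eq_iff \<rho>_def \<nu>_def hom split: coord.split)
  then have "subst Const \<nu> (subst Const \<rho> f) = f"
    by (simp add: subst_subst subst_Const_Var)
  then have "subst Const \<rho> f \<noteq> 0"
    using \<open>f \<noteq> 0\<close> by (auto simp: hom)
  then obtain k where k: "k \<in> keys (subst Const \<rho> f)"
    by (metis ex_in_conv keys_eq_empty)
  \<comment> \<open>Upper and lower bounds on the x-degree, as families compatible with products, so
    that \<open>prod_graded\<close> applies to both.\<close>
  define L :: "nat \<Rightarrow> ('n coord, 'k) mpoly set" where "L n = {g. \<forall>k\<in>keys g. xdeg k \<le> n}" for n
  define U :: "nat \<Rightarrow> ('n coord, 'k) mpoly set" where "U n = {g. \<forall>k\<in>keys g. n \<le> xdeg k}" for n
  have xdeg_add: "xdeg (a + b) = xdeg a + xdeg b" for a b :: "'n coord \<Rightarrow>\<^sub>0 nat"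
    by (simp add: lookup_add sum.distrib)
  have one: "1 \<in> L 0" "1 \<in> U 0"
    by (auto simp: L_def U_def keys_one)
  have "xdeg (single (X i) (Suc 0)) = 1" "xdeg (single (Y i) (Suc 0)) = 0" for i :: 'n
    by (simp_all add: lookup_single when_def)
  then have \<rho>: "\<rho> (X i) \<in> L 0" "\<rho> (Y i) \<in> L 1" "\<rho>' (X i) \<in> U 1" "\<rho>' (Y i) \<in> U 0" for i
    using keys_add[of "Var (X i) :: ('n coord, 'k) mpoly" "Var (Y i)"]
    by (auto simp: \<rho>_def \<rho>'_def L_def U_def Var_def simp del: sum_eq_0_iff)
  have L_mult: "x * y \<in> L (a + b)" if "x \<in> L a" "y \<in> L b" for a b x y
    unfolding L_def
  proof (rule CollectI, rule ballI)
    fix k assume "k \<in> keys (x * y)"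
    then obtain k1 k2 where "k = k1 + k2" "k1 \<in> keys x" "k2 \<in> keys y"
      using keys_mult[of x y] by blast
    with that show "xdeg k \<le> a + b"
      unfolding L_def using xdeg_add add_mono by fastforce
  qed
  have U_mult: "x * y \<in> U (a + b)" if "x \<in> U a" "y \<in> U b" for a b x y
    unfolding U_def
  proof (rule CollectI, rule ballI)
    fix k assume "k \<in> keys (x * y)"
    then obtain k1 k2 where "k = k1 + k2" "k1 \<in> keys x" "k2 \<in> keys y"
      using keys_mult[of x y] by blast
    with that show "a + b \<le> xdeg k"
      unfolding U_def using xdeg_add add_mono by fastforce
  qed
  have mono_bounds: "eval_monomial \<rho> m \<in> L (ydeg m)" "eval_monomial \<rho>' m \<in> U (xdeg m)" for m
  proof -
    have "(\<Prod>i\<in>UNIV. \<rho> (X i) ^ lookup m (X i)) \<in> L (\<Sum>i\<in>UNIV. lookup m (X i) * 0)"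
      by (rule prod_graded[of L]) (rule one L_mult \<rho> | assumption)+
    moreover have "(\<Prod>i\<in>UNIV. \<rho> (Y i) ^ lookup m (Y i)) \<in> L (\<Sum>i\<in>UNIV. lookup m (Y i) * 1)"
      by (rule prod_graded[of L]) (rule one L_mult \<rho> | assumption)+
    ultimately show "eval_monomial \<rho> m \<in> L (ydeg m)"
      using L_mult unfolding eval_monomial_coord by fastforce
    have "(\<Prod>i\<in>UNIV. \<rho>' (X i) ^ lookup m (X i)) \<in> U (\<Sum>i\<in>UNIV. lookup m (X i) * 1)"
      by (rule prod_graded[of U]) (rule one U_mult \<rho> | assumption)+
    moreover have "(\<Prod>i\<in>UNIV. \<rho>' (Y i) ^ lookup m (Y i)) \<in> U (\<Sum>i\<in>UNIV. lookup m (Y i) * 0)"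
      by (rule prod_graded[of U]) (rule one U_mult \<rho> | assumption)+
    ultimately show "eval_monomial \<rho>' m \<in> U (xdeg m)"
      using U_mult unfolding eval_monomial_coord by fastforce
  qed
  from k obtain m where "m \<in> keys f" "k \<in> keys (eval_monomial \<rho> m)"
    by (rule keys_subst)
  then have "xdeg k \<le> q"
    using mono_bounds(1)[of m] bideg[of m] by (auto simp: L_def)
  moreover from k obtain m where "m \<in> keys f" "k \<in> keys (eval_monomial \<rho>' m)"
    unfolding eq by (rule keys_subst)
  then have "p \<le> xdeg k"
    using mono_bounds(2)[of m] bideg[of m] by (auto simp: U_def)
  ultimately show ?thesis by linarith
qed

section \<open>Splitting off one column\<close>

lemma single_times_left_cancel:
  fixes f g :: "'m::cancel_comm_monoid_add \<Rightarrow>\<^sub>0 'a::comm_ring_1"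
  assumes "single u 1 * f = single u 1 * g"
  shows "f = g"
proof (rule poly_mapping_eqI)
  fix k show "lookup f k = lookup g k"
    using arg_cong[OF assms, of "\<lambda>x. lookup x (u + k)"] by (simp add: lookup_single_times)
qed

lemma eval_monomial_cong: "(\<And>v. v \<in> keys m \<Longrightarrow> \<sigma> v = \<tau> v) \<Longrightarrow> eval_monomial \<sigma> m = eval_monomial \<tau> m"
  by (simp add: eval_monomial_def)

lemma xdeg_add: "xdeg (m + n) = xdeg m + xdeg n" and ydeg_add: "ydeg (m + n) = ydeg m + ydeg n"
  by (simp_all add: lookup_add sum.distrib)

lemma xdeg_single: "xdeg (single (X j) a) = a" "xdeg (single (Y j) a) = 0"
  and ydeg_single: "ydeg (single (X j) a) = 0" "ydeg (single (Y j) a) = a"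
  by (simp_all add: lookup_single when_def)

lemma single_le_decompose:
  fixes m :: "'v \<Rightarrow>\<^sub>0 nat"
  assumes "s \<le> lookup m v"
  shows "m = single v s + (m - single v s)"
  by (rule poly_mapping_eqI) (use assms in \<open>auto simp: lookup_add lookup_minus lookup_single when_def\<close>)

text \<open>Let \<open>s\<close> be the least exponent of \<open>Y j\<close> and
  \<open>a = d - s\<close>. The shear fixes \<open>Y j\<close>, so the quotient of \<open>f\<close>
  by the \<open>s\<close>-th power of \<open>Y j\<close> is still invariant, and the bidegree
  inequality for it, \<open>p \<le> q - s\<close>, is the ballot condition. The coefficient
  \<open>g\<close> belongs to the \<open>a\<close>-th power of \<open>X j\<close> in this
  quotient.\<close>

lemma shear_invariant_extract:
  fixes f :: "('n::finite coord, 'k::field) mpoly"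
  assumes inv: "shear f = f" and "f \<noteq> 0"
    and bideg: "\<And>m. m \<in> keys f \<Longrightarrow> xdeg m = p \<and> ydeg m = q"
    and deg: "\<And>m. m \<in> keys f \<Longrightarrow> lookup m (X j) + lookup m (Y j) = d"
  obtains a and g :: "('n coord, 'k) mpoly" where "a \<le> d" "p + (d - a) \<le> q" "g \<noteq> 0" "shear g = g"
    "\<And>k. k \<in> keys g \<Longrightarrow> lookup k (X j) = 0 \<and> lookup k (Y j) = 0 \<and>
      single (X j) a + single (Y j) (d - a) + k \<in> keys f"
proof -
  have ne: "keys f \<noteq> {}" using \<open>f \<noteq> 0\<close> by simp
  define s where "s = Min ((\<lambda>m. lookup m (Y j)) ` keys f)"
  have s_le: "s \<le> lookup m (Y j)" if "m \<in> keys f" for m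
    unfolding s_def using that by (intro Min_le) auto
  have "s \<in> (\<lambda>m. lookup m (Y j)) ` keys f"
    unfolding s_def using ne by (intro Min_in) auto
  then obtain m0 where m0: "m0 \<in> keys f" "lookup m0 (Y j) = s" by auto
  define a where "a = d - s"
  have "s \<le> d" using deg[OF m0(1)] m0(2) by simp
  then have a: "a \<le> d" "d - a = s" by (auto simp: a_def)
  define u where "u = single (Y j) s"
  have "\<exists>g. f = single u 1 * g"
  proof (rule exists_monomial_quotient)
    fix m assume "m \<in> keys f"
    then show "\<exists>m'. m = u + m'"
      using single_le_decompose[OF s_le] unfolding u_def by blast
  qed
  then obtain f' where f': "f = single u 1 * f'" by blast
  have lookup_f: "lookup f (u + k) = lookup f' k" for k
    by (simp add: f' lookup_single_times)
  then have keys_f': "k \<in> keys f' \<longleftrightarrow> u + k \<in> keys f" for k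
    by (simp add: in_keys_iff)
  note hom = ring_homD[OF ring_hom_subst[OF ring_hom_Const]] subst_Var[OF ring_hom_Const]
  have "single u 1 = eval_monomial (Var :: 'n coord \<Rightarrow> ('n coord, 'k) mpoly) u"
    by (simp only: eval_monomial_Var)
  then have "single u 1 = (Var (Y j) :: ('n coord, 'k) mpoly) ^ s"
    by (simp add: u_def)
  then have "shear (single u 1 :: ('n coord, 'k) mpoly) = single u 1"
    by (simp add: shear_def hom)
  then have "single u 1 * shear f' = single u 1 * f'"
    using inv unfolding f' shear_def by (simp add: hom)
  then have inv': "shear f' = f'"
    by (rule single_times_left_cancel)
  have "f' \<noteq> 0" using \<open>f \<noteq> 0\<close> f' by auto
  have ydeg_u: "s + ydeg k = q" if "k \<in> keys f'" for k
    using bideg[of "u + k"] that unfolding keys_f' u_def ydeg_add ydeg_single by simp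
  have "p \<le> q - s"
  proof (rule shear_invariant_bidegree_le[OF inv' \<open>f' \<noteq> 0\<close>])
    fix k assume k: "k \<in> keys f'"
    then have "xdeg k = p"
      using bideg[of "u + k"] unfolding keys_f' u_def xdeg_add xdeg_single by simp
    then show "xdeg k = p \<and> ydeg k = q - s"
      using ydeg_u[OF k] by linarith
  qed
  \<comment> \<open>Subtraction is truncated, so for \<open>p = 0\<close> the previous bound says
    nothing about \<open>s\<close>.\<close>
  moreover have "s \<le> q"
    using ydeg_u \<open>f' \<noteq> 0\<close> by (metis ex_in_conv keys_eq_empty le_add1)
  ultimately have pq: "p + s \<le> q" by linarith

  \<comment> \<open>Setting \<open>X j\<close> to 1 and \<open>Y j\<close> to 0 commutes with the
    shear, since \<open>X j - Y j\<close> also goes to 1. This is what keeps \<open>g\<close>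
    invariant.\<close>
  define \<epsilon> :: "'n coord \<Rightarrow> ('n coord, 'k) mpoly" where
    "\<epsilon> v = (if v = X j then 1 else if v = Y j then 0 else Var v)" for v
  define g where "g = subst Const \<epsilon> f'"
  have "subst Const \<epsilon> (shear f') = shear g"
    unfolding g_def shear_def subst_subst
    by (rule arg_cong[of _ _ "\<lambda>\<sigma>. subst Const \<sigma> f'"])
      (auto simp: fun_eq_iff \<epsilon>_def hom split: coord.split)
  then have "shear g = g"
    by (simp add: inv' g_def)
  have deg': "lookup k (X j) + lookup k (Y j) = a" if "k \<in> keys f'" for k
    using deg[of "u + k"] that by (simp add: keys_f' u_def lookup_add lookup_single a_def)
  have eval_zero: "eval_monomial \<epsilon> k = 0" if "lookup k (Y j) \<noteq> 0" for k
  proof -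
    have "\<epsilon> (Y j) ^ lookup k (Y j) = 0" using that by (simp add: \<epsilon>_def zero_power)
    then show ?thesis
      unfolding eval_monomial_def using that
      by (intro prod_zero bexI[of _ "Y j"]) (auto simp: in_keys_iff)
  qed
  have eval_pure: "eval_monomial \<epsilon> k = single (k - single (X j) a) 1"
    if "k \<in> keys f'" "lookup k (Y j) = 0" for k
  proof -
    have kX: "lookup k (X j) = a" using deg'[OF that(1)] that(2) by simp
    define k0 where "k0 = k - single (X j) a"
    have k: "k = single (X j) a + k0"
      unfolding k0_def by (rule single_le_decompose) (simp add: kX)
    have "lookup k0 (X j) = 0" "lookup k0 (Y j) = 0"
      using that(2) kX by (auto simp: k0_def lookup_minus lookup_single)
    then have "eval_monomial \<epsilon> k0 = eval_monomial Var k0"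
      by (intro eval_monomial_cong) (auto simp: \<epsilon>_def in_keys_iff)
    then show ?thesis
      unfolding k0_def[symmetric] by (simp add: k eval_monomial_add eval_monomial_Var \<epsilon>_def)
  qed
  have keys_g: "lookup k (X j) = 0 \<and> lookup k (Y j) = 0 \<and>
      single (X j) a + single (Y j) (d - a) + k \<in> keys f" if "k \<in> keys g" for k
  proof -
    from that obtain m where m: "m \<in> keys f'" "k \<in> keys (eval_monomial \<epsilon> m)"
      unfolding g_def by (rule keys_subst)
    have mY: "lookup m (Y j) = 0" using eval_zero m(2) by fastforce
    have mX: "lookup m (X j) = a" using deg'[OF m(1)] mY by simp
    have k: "k = m - single (X j) a"
      using m(2) eval_pure[OF m(1) mY] by simp
    have "m = single (X j) a + k"
      unfolding k by (rule single_le_decompose) (simp add: mX)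
    then have "u + m = single (X j) a + single (Y j) (d - a) + k"
      by (simp add: u_def a(2) ac_simps)
    moreover have "lookup k (X j) = 0" "lookup k (Y j) = 0"
      using mX mY by (auto simp: k lookup_minus lookup_single)
    ultimately show ?thesis
      using m(1) keys_f' by metis
  qed
  have "g \<noteq> 0"
  proof -
    define m1 where "m1 = m0 - u"
    have m0': "m0 = u + m1"
      unfolding m1_def u_def by (rule single_le_decompose) (simp add: m0)
    then have m1: "m1 \<in> keys f'" using m0(1) keys_f' by simp
    have m1Y: "lookup m1 (Y j) = 0" using m0(2) by (simp add: m1_def u_def lookup_minus)
    \<comment> \<open>In the terms of \<open>f'\<close> free of \<open>Y j\<close> the exponent of
      \<open>X j\<close> is always \<open>a\<close>, so setting \<open>X j\<close> to 1 merges no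
      two of them and the coefficient at \<open>m1\<close> survives.\<close>
    have "lookup f' m * lookup (eval_monomial \<epsilon> m) (m1 - single (X j) a) = (if m = m1 then lookup f' m1 else 0)"
      if m: "m \<in> keys f'" for m
    proof (cases "lookup m (Y j) = 0")
      case True
      have "m = single (X j) a + (m - single (X j) a)" "m1 = single (X j) a + (m1 - single (X j) a)"
        using deg'[OF m] True deg'[OF m1] m1Y by (auto intro!: single_le_decompose)
      then have "m - single (X j) a = m1 - single (X j) a \<longleftrightarrow> m = m1" by metis
      then show ?thesis
        by (simp add: eval_pure[OF m True] lookup_single when_def)
    next
      case False
      then show ?thesis using eval_zero m1Y by auto
    qed
    then have "lookup g (m1 - single (X j) a) = (\<Sum>m\<in>keys f'. if m = m1 then lookup f' m1 else 0)"
      by (simp add: g_def subst_eval_monomial lookup_sum lookup_Const_times)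
    also have "\<dots> = lookup f' m1" using m1 by simp
    finally show ?thesis using m1 by (auto simp: in_keys_iff)
  qed
  from pq a(2) have "p + (d - a) \<le> q" by simp
  from that[OF a(1) this \<open>g \<noteq> 0\<close> \<open>shear g = g\<close> keys_g] show thesis .
qed

text \<open>
  A list entry \<open>a\<close> stands for \<open>x\<^sub>j\<^sup>a y\<^sub>j\<^sup>d\<^sup>-\<^sup>a\<close>; the height \<open>h\<close> is the number of earlier \<open>x\<close>s not yet matched with
  a later \<open>y\<close>, so \<open>d - a \<le> h\<close> is required before \<open>a\<close> new ones are added.
\<close>

fun ballot :: "nat \<Rightarrow> nat \<Rightarrow> nat list \<Rightarrow> bool" where
  "ballot d h [] \<longleftrightarrow> h = 0"
| "ballot d h (a # as) \<longleftrightarrow> a \<le> d \<and> d \<le> h + a \<and> ballot d (h + a + a - d) as"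

fun path_monomial :: "nat \<Rightarrow> 'n list \<Rightarrow> nat list \<Rightarrow> 'n coord \<Rightarrow>\<^sub>0 nat" where
  "path_monomial d (j # js) (a # as) = single (X j) a + single (Y j) (d - a) + path_monomial d js as"
| "path_monomial d _ _ = 0"

text \<open>The remaining columns carry \<open>q - p\<close> more \<open>Y\<close> than
  \<open>X\<close>; this surplus must match the \<open>X\<close> already placed, so it is the height
  of the path.\<close>

lemma shear_invariant_ballot:
  fixes f :: "('n::finite coord, 'k::field) mpoly"
  assumes "distinct js" "shear f = f" "f \<noteq> 0"
    and "\<And>m. m \<in> keys f \<Longrightarrow> xdeg m = p \<and> ydeg m = q"
    and "\<And>m i. m \<in> keys f \<Longrightarrow> lookup m (X i) + lookup m (Y i) = (if i \<in> set js then d else 0)"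
  shows "\<exists>as. length as = length js \<and> ballot d (q - p) as \<and> path_monomial d js as \<in> keys f"
  using assms
proof (induction js arbitrary: f p q)
  case Nil
  from \<open>f \<noteq> 0\<close> obtain m where m: "m \<in> keys f" by (metis ex_in_conv keys_eq_empty)
  have "m = 0" using Nil.prems(5)[OF m] by (intro coord_monomial_eqI) auto
  with m Nil.prems(4)[OF m] show ?case by auto
next
  case (Cons j js)
  obtain a and g :: "('n coord, 'k) mpoly" where a: "a \<le> d" "p + (d - a) \<le> q" and g: "g \<noteq> 0" "shear g = g"
    and keys_g: "\<And>k. k \<in> keys g \<Longrightarrow> lookup k (X j) = 0 \<and> lookup k (Y j) = 0 \<and>
      single (X j) a + single (Y j) (d - a) + k \<in> keys f"
    by (rule shear_invariant_extract[OF Cons.prems(2,3), of p q j d]) (use Cons.prems in auto)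
  have deg: "a + xdeg k = p \<and> (d - a) + ydeg k = q" if "k \<in> keys g" for k
    using Cons.prems(4)[of "single (X j) a + single (Y j) (d - a) + k"] keys_g[OF that]
    unfolding xdeg_add ydeg_add xdeg_single ydeg_single by simp
  have "a \<le> p" using deg g(1) by (metis ex_in_conv keys_eq_empty le_add1)
  have "\<exists>as. length as = length js \<and> ballot d (q - (d - a) - (p - a)) as \<and> path_monomial d js as \<in> keys g"
  proof (rule Cons.IH)
    show "distinct js" using Cons.prems(1) by simp
    show "xdeg k = p - a \<and> ydeg k = q - (d - a)" if "k \<in> keys g" for k
      using deg[OF that] by linarith
    show "lookup k (X i) + lookup k (Y i) = (if i \<in> set js then d else 0)" if "k \<in> keys g" for k i
      using Cons.prems(5)[of "single (X j) a + single (Y j) (d - a) + k" i] Cons.prems(1) keys_g[OF that]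
      by (cases "i = j") (auto simp: lookup_add lookup_single)
  qed (fact g)+
  then obtain as where as: "length as = length js" "ballot d (q - (d - a) - (p - a)) as" "path_monomial d js as \<in> keys g"
    by blast
  \<comment> \<open>The new degree difference is the height update of \<open>ballot\<close>;
    truncation does no harm because \<open>a \<le> p\<close> and
    \<open>p + (d - a) \<le> q\<close>.\<close>
  have "q - (d - a) - (p - a) = (q - p) + a + a - d"
    using a \<open>a \<le> p\<close> by linarith
  then have "ballot d ((q - p) + a + a - d) as"
    using as(2) by (simp only:)
  moreover have "d \<le> (q - p) + a"
    using a by linarith
  ultimately have "ballot d (q - p) (a # as)"
    using a(1) by (simp only: ballot.simps)
  moreover have "path_monomial d (j # js) (a # as) \<in> keys f"
    using keys_g[OF as(3)] by simp
  ultimately show ?case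
    using as(1) by (intro exI[of _ "a # as"]) simp
qed

section \<open>Brackets and their leading monomials\<close>

lemma SL2_invariant_Const: "SL2_invariant (Const c)"
  by (simp add: SL2_invariant_def coaction_def subst_Const[OF ring_hom_comp[OF ring_hom_Const ring_hom_Const]])

lemma ring_hom_coaction: "ring_hom coaction"
  unfolding coaction_def by (rule ring_hom_subst[OF ring_hom_comp[OF ring_hom_Const ring_hom_Const]])

lemma SL2_invariant_add: "SL2_invariant f \<Longrightarrow> SL2_invariant g \<Longrightarrow> SL2_invariant (f + g)"
  unfolding SL2_invariant_def ring_homD(2)[OF ring_hom_coaction] ring_homD(2)[OF ring_hom_Const]
  by (metis add_diff_add dvd_add)

lemma SL2_invariant_mult:
  assumes "SL2_invariant f" "SL2_invariant g"
  shows "SL2_invariant (f * g)"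
proof -
  have "coaction (f * g) - Const (f * g) =
    coaction f * (coaction g - Const g) + (coaction f - Const f) * Const g"
    by (simp add: ring_homD[OF ring_hom_coaction] ring_homD[OF ring_hom_Const] algebra_simps)
  then show ?thesis
    using assms unfolding SL2_invariant_def by (metis dvd_add dvd_mult dvd_mult2)
qed

lemma SL2_invariant_1: "SL2_invariant 1"
  using SL2_invariant_Const[of 1] by (simp add: ring_homD[OF ring_hom_Const])

definition bracket :: "'n \<Rightarrow> 'n \<Rightarrow> ('n coord, 'k::field) mpoly" where
  "bracket i j = Var (X i) * Var (Y j) - Var (X j) * Var (Y i)"

lemma coaction_Var: "coaction (Var v) = generic_action v"
  unfolding coaction_def by (rule subst_Var[OF ring_hom_comp[OF ring_hom_Const ring_hom_Const]])

text \<open>The coaction multiplies a two by two minor by the determinant of the generic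
  matrix.\<close>

lemma SL2_invariant_bracket: "SL2_invariant (bracket i j)"
proof -
  have "coaction (bracket i j) - Const (bracket i j) =
    (Var a_entry * Var d_entry - Var b_entry * Var c_entry - 1) * Const (bracket i j)"
    by (simp add: bracket_def coaction_Var ring_homD[OF ring_hom_coaction] ring_homD[OF ring_hom_Const] algebra_simps)
  then show ?thesis
    unfolding SL2_invariant_def by (rule dvdI)
qed

definition xweight :: "('n::finite \<Rightarrow> nat) \<Rightarrow> ('n coord \<Rightarrow>\<^sub>0 nat) \<Rightarrow> nat" where
  "xweight w m = (\<Sum>i\<in>UNIV. w i * lookup m (X i))"

lemma xweight_add: "xweight w (m + n) = xweight w m + xweight w n"
  by (simp add: xweight_def lookup_add algebra_simps sum.distrib)

definition coldeg :: "('n coord \<Rightarrow>\<^sub>0 nat) \<Rightarrow> 'n \<Rightarrow> nat" where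
  "coldeg m i = lookup m (X i) + lookup m (Y i)"

lemma coldeg_add: "coldeg (m + n) i = coldeg m i + coldeg n i"
  by (simp add: coldeg_def lookup_add)

text \<open>The weight is additive, so leading monomials multiply. It is no monomial order: distinct
  monomials may have equal weight, and only strict domination by \<open>m\<close> is asked. Equality
  of \<open>coldeg\<close> lets the multidegree of \<open>f\<close> be read off from
  \<open>m\<close>.\<close>

definition leading_invariant ::
    "('n::finite \<Rightarrow> nat) \<Rightarrow> ('n coord, 'k::field) mpoly \<Rightarrow> ('n coord \<Rightarrow>\<^sub>0 nat) \<Rightarrow> bool" where
  "leading_invariant w f m \<longleftrightarrow> SL2_invariant f \<and>
    (\<exists>g. f = single m 1 + g \<and> (\<forall>k\<in>keys g. xweight w k < xweight w m \<and> coldeg k = coldeg m))"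

lemma leading_invariant_1: "leading_invariant w 1 0"
  unfolding leading_invariant_def by (intro conjI exI[of _ 0]) (simp_all add: SL2_invariant_1)

lemma leading_invariant_mult:
  assumes "leading_invariant w f m" "leading_invariant w g n"
  shows "leading_invariant w (f * g) (m + n)"
proof -
  obtain f0 g0 where f0: "f = single m 1 + f0" "\<And>k. k \<in> keys f0 \<Longrightarrow> xweight w k < xweight w m \<and> coldeg k = coldeg m"
    and g0: "g = single n 1 + g0" "\<And>k. k \<in> keys g0 \<Longrightarrow> xweight w k < xweight w n \<and> coldeg k = coldeg n"
    and inv: "SL2_invariant f" "SL2_invariant g"
    using assms unfolding leading_invariant_def by metis
  define h where "h = single m 1 * g0 + f0 * g"
  have "f * g = single (m + n) 1 + h"
    by (simp add: f0(1) g0(1) h_def algebra_simps mult_single)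
  moreover have "xweight w k < xweight w (m + n) \<and> coldeg k = coldeg (m + n)" if "k \<in> keys h" for k
  proof -
    have "k \<in> keys (single m 1 * g0) \<or> k \<in> keys (f0 * g)"
      using that keys_add[of "single m 1 * g0" "f0 * g"] unfolding h_def by blast
    then show ?thesis
    proof
      assume "k \<in> keys (single m 1 * g0)"
      then obtain k' where "k' \<in> keys g0" "k = m + k'" by (rule keys_single_times)
      then show ?thesis using g0(2)[of k'] by (auto simp: xweight_add fun_eq_iff coldeg_add)
    next
      assume "k \<in> keys (f0 * g)"
      then obtain k1 k2 where k: "k = k1 + k2" "k1 \<in> keys f0" "k2 \<in> keys g"
        using keys_mult[of f0 g] by blast
      have "k2 = n \<or> k2 \<in> keys g0"
        using k(3) keys_add[of "single n (1::'b)" g0] unfolding g0(1) by auto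
      then have "xweight w k2 \<le> xweight w n \<and> coldeg k2 = coldeg n"
        using g0(2) by fastforce
      then show ?thesis
        using f0(2)[OF k(2)] by (auto simp: k(1) xweight_add fun_eq_iff coldeg_add)
    qed
  qed
  ultimately show ?thesis
    unfolding leading_invariant_def using SL2_invariant_mult[OF inv] by blast
qed

lemma leading_invariant_bracket:
  assumes "w j < w i"
  shows "leading_invariant w (bracket i j) (single (X i) 1 + single (Y j) 1)"
proof -
  have weight: "xweight w (single (X i) (Suc 0)) = w i" "xweight w (single (Y i) (Suc 0)) = 0" for i
    by (simp_all add: xweight_def lookup_single when_def if_distrib cong: if_cong)
  have "coldeg (single (X j) (Suc 0) + single (Y i) (Suc 0)) = coldeg (single (X i) (Suc 0) + single (Y j) (Suc 0))"
    by (auto simp: coldeg_def fun_eq_iff lookup_add lookup_single when_def)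
  then show ?thesis
    unfolding leading_invariant_def
    by (intro conjI SL2_invariant_bracket exI[of _ "- single (single (X j) 1 + single (Y i) 1) 1"])
      (use assms in \<open>auto simp: bracket_def Var_def mult_single xweight_add weight\<close>)
qed

section \<open>Bracket products with a prescribed leading monomial\<close>

definition stack_monomial :: "'n list \<Rightarrow> 'n coord \<Rightarrow>\<^sub>0 nat" where
  "stack_monomial st = (\<Sum>s\<leftarrow>st. single (X s) 1)"

lemma stack_monomial_append: "stack_monomial (st @ st') = stack_monomial st + stack_monomial st'"
  by (simp add: stack_monomial_def)

lemma stack_monomial_replicate: "stack_monomial (replicate a j) = single (X j) a"
  by (induction a) (simp_all add: stack_monomial_def single_add[symmetric])

lemma leading_invariant_brackets:
  fixes w :: "'n::finite \<Rightarrow> nat"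
  assumes "\<And>s. s \<in> set st \<Longrightarrow> w j < w s"
  shows "\<exists>f :: ('n coord, 'k::field) mpoly. leading_invariant w f (stack_monomial st + single (Y j) (length st))"
  using assms
proof (induction st)
  case Nil
  show ?case using leading_invariant_1 by (auto simp: stack_monomial_def)
next
  case (Cons s st)
  then obtain f :: "('n coord, 'k) mpoly" where "leading_invariant w f (stack_monomial st + single (Y j) (length st))" by auto
  then have "leading_invariant w (bracket s j * f)
      ((single (X s) 1 + single (Y j) 1) + (stack_monomial st + single (Y j) (length st)))"
    using Cons.prems by (intro leading_invariant_mult leading_invariant_bracket) auto
  moreover have "single (Y j) (length (s # st)) = single (Y j) 1 + single (Y j) (length st)"
    by (simp add: single_add[symmetric])
  ultimately show ?case
    by (auto simp: stack_monomial_def ac_simps)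
qed

text \<open>The stack holds the indices of the \<open>X\<close>s that still wait for a matching \<open>Y\<close>.\<close>

lemma exists_ballot_invariant:
  fixes w :: "'n::finite \<Rightarrow> nat"
  assumes "sorted_wrt (\<lambda>i j. w j < w i) js" "\<And>s j. s \<in> set st \<Longrightarrow> j \<in> set js \<Longrightarrow> w j < w s"
    and "length as = length js" "ballot d (length st) as"
  shows "\<exists>f :: ('n coord, 'k::field) mpoly. leading_invariant w f (stack_monomial st + path_monomial d js as)"
  using assms
proof (induction js arbitrary: st as)
  case Nil
  then show ?case using leading_invariant_1 by (auto simp: stack_monomial_def)
next
  case (Cons j js)
  then obtain a as' where as: "as = a # as'" by (cases as) auto
  define b where "b = d - a"
  have a: "a \<le> d" "d \<le> length st + a" "ballot d (length st + a + a - d) as'"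
    using Cons.prems(4) as by auto
  have b: "b \<le> length st" using a(2) by (auto simp: b_def)
  \<comment> \<open>The \<open>b\<close> letters \<open>Y j\<close> are matched with the first
    \<open>b\<close> waiting entries, and the \<open>a\<close> new copies of \<open>j\<close> join
    only afterwards. So no bracket pairs \<open>j\<close> with itself, which would vanish.\<close>
  define st' where "st' = drop b st @ replicate a j"
  have "length st' = length st + a + a - d"
    using a(1,2) by (simp add: st'_def b_def)
  moreover have "w j' < w s" if "s \<in> set st'" "j' \<in> set js" for s j'
    using that Cons.prems(1,2) by (fastforce simp: st'_def dest: in_set_dropD)
  ultimately obtain f :: "('n coord, 'k) mpoly" where f: "leading_invariant w f (stack_monomial st' + path_monomial d js as')"
    using Cons.IH[of st' as'] Cons.prems(1,3) a(3) as by auto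
  obtain g :: "('n coord, 'k) mpoly" where g: "leading_invariant w g (stack_monomial (take b st) + single (Y j) b)"
    using leading_invariant_brackets[of "take b st" w j] Cons.prems(2)[of _ j] b
    by (auto dest: in_set_takeD simp: min_absorb2)
  have "stack_monomial st = stack_monomial (take b st) + stack_monomial (drop b st)"
    by (simp flip: stack_monomial_append)
  then have "(stack_monomial (take b st) + single (Y j) b) + (stack_monomial st' + path_monomial d js as') =
      stack_monomial st + path_monomial d (j # js) as"
    by (simp add: as st'_def stack_monomial_append stack_monomial_replicate b_def ac_simps)
  with leading_invariant_mult[OF g f] show ?case by auto
qed

section \<open>Dimension\<close>

text \<open>\<open>dim\<close> is 0 also for a space with an infinite basis. Here
  finite-dimensionality is part of the notion, which later yields finiteness of the ranks.\<close>

definition (in vector_space) has_dim :: "'b set \<Rightarrow> nat \<Rightarrow> bool" where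
  "has_dim V n \<longleftrightarrow> (\<exists>B\<subseteq>V. finite B \<and> independent B \<and> V \<subseteq> span B \<and> card B = n)"

context vector_space
begin

lemma has_dim_unique: "has_dim V m \<Longrightarrow> has_dim V n \<Longrightarrow> m = n"
  unfolding has_dim_def by (metis basis_card_eq_dim)

lemma has_dim_independent:
  assumes "has_dim V n" "B \<subseteq> V" "independent B"
  shows "finite B \<and> card B \<le> n"
proof -
  from assms(1) obtain A where "finite A" "V \<subseteq> span A" "card A = n"
    unfolding has_dim_def by blast
  then show ?thesis
    using independent_span_bound[of A B] assms by auto
qed

lemma has_dim_subset:
  assumes "has_dim V n" "W \<subseteq> V"
  shows "\<exists>m\<le>n. has_dim W m"
proof -
  obtain B where B: "B \<subseteq> W" "independent B" "W \<subseteq> span B"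
    using maximal_independent_subset by blast
  then have "finite B \<and> card B \<le> n"
    using has_dim_independent[OF assms(1), of B] assms(2) by blast
  with B show ?thesis
    unfolding has_dim_def by blast
qed

lemma has_dim_of_span:
  assumes "W \<subseteq> span A" "finite A"
  shows "\<exists>m\<le>card A. has_dim W m"
proof -
  obtain B where B: "B \<subseteq> W" "independent B" "W \<subseteq> span B"
    using maximal_independent_subset by blast
  then have "finite B \<and> card B \<le> card A"
    using independent_span_bound[OF assms(2), of B] assms(1) by blast
  with B show ?thesis
    unfolding has_dim_def by blast
qed

lemma has_dim_zero: "has_dim {0} 0"
  unfolding has_dim_def by (intro exI[of _ "{}"]) (auto simp: independent_empty)

end

context vector_space_pair
begin

text \<open>Rank-nullity for a map that is linear on \<open>V\<close> only: a
  \<open>graded_hom\<close> is constrained just on the direct sum of its source, so a differential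
  need not be linear on the ambient type.\<close>

lemma has_dim_kernel_image:
  assumes V: "vs1.subspace V"
    and add: "\<And>u v. u \<in> V \<Longrightarrow> v \<in> V \<Longrightarrow> f (u + v) = f u + f v"
    and scale: "\<And>c u. u \<in> V \<Longrightarrow> f (s1 c u) = s2 c (f u)"
    and ker: "vs1.has_dim {u \<in> V. f u = 0} k" and im: "vs2.has_dim (f ` V) r"
  shows "vs1.has_dim V (k + r)"
proof -
  obtain A where A: "A \<subseteq> {u \<in> V. f u = 0}" "finite A" "vs1.independent A"
      "{u \<in> V. f u = 0} \<subseteq> vs1.span A" "card A = k"
    using ker unfolding vs1.has_dim_def by blast
  obtain D where D: "D \<subseteq> f ` V" "finite D" "vs2.independent D" "f ` V \<subseteq> vs2.span D" "card D = r"
    using im unfolding vs2.has_dim_def by blast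
  then have "\<forall>y\<in>D. \<exists>x. x \<in> V \<and> f x = y" by blast
  then obtain g where g: "\<And>y. y \<in> D \<Longrightarrow> g y \<in> V \<and> f (g y) = y"
    by metis
  have inj: "inj_on g D" using g by (metis inj_onI)
  define C where "C = g ` D"
  have C: "C \<subseteq> V" "finite C" "card C = r"
    using g D inj by (auto simp: C_def card_image)
  have zero: "f 0 = 0" using add[of 0 0] vs1.subspace_0[OF V] by simp
  have sum: "(\<Sum>v\<in>S. s1 (c v) v) \<in> V \<and> f (\<Sum>v\<in>S. s1 (c v) v) = (\<Sum>v\<in>S. s2 (c v) (f v))"
    if "finite S" "S \<subseteq> V" for S c
    using that
    by (induction S)
      (auto simp: zero add scale vs1.subspace_0[OF V] vs1.subspace_add[OF V] vs1.subspace_scale[OF V])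
  have disj: "A \<inter> C = {}"
  proof (rule equals0I)
    fix x assume x: "x \<in> A \<inter> C"
    then obtain y where "y \<in> D" "x = g y" by (auto simp: C_def)
    moreover have "f x = 0" using x A(1) by auto
    ultimately have "0 \<in> D" using g by force
    then show False using D(3) vs2.dependent_zero by blast
  qed
  have "vs1.independent (A \<union> C)"
  proof (rule vs1.independent_if_scalars_zero)
    show "finite (A \<union> C)" using A C by simp
    fix c x assume *: "(\<Sum>x\<in>A \<union> C. s1 (c x) x) = 0" and x: "x \<in> A \<union> C"
    have "(\<Sum>x\<in>A \<union> C. s2 (c x) (f x)) = 0"
      using sum[of "A \<union> C" c] A C * zero by auto
    moreover have "(\<Sum>x\<in>A. s2 (c x) (f x)) = 0"
      using A(1) by (intro sum.neutral) auto
    moreover have "(\<Sum>x\<in>C. s2 (c x) (f x)) = (\<Sum>y\<in>D. s2 (c (g y)) y)"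
      unfolding C_def using inj g by (simp add: sum.reindex)
    ultimately have "(\<Sum>y\<in>D. s2 (c (g y)) y) = 0"
      using A(2) C(2) disj by (simp add: sum.union_disjoint)
    then have "c (g y) = 0" if "y \<in> D" for y
      using vs2.independentD[OF D(3,2) subset_refl, of "\<lambda>y. c (g y)" y] that by simp
    then have cC: "c x = 0" if "x \<in> C" for x
      using that by (auto simp: C_def)
    then have "(\<Sum>x\<in>A. s1 (c x) x) = 0"
      using * A(2) C(2) disj by (simp add: sum.union_disjoint)
    then have "c x = 0" if "x \<in> A" for x
      using vs1.independentD[OF A(3,2) subset_refl, of c x] that by simp
    with cC x show "c x = 0" by blast
  qed
  moreover have "V \<subseteq> vs1.span (A \<union> C)"
  proof
    fix v assume v: "v \<in> V"
    then have "f v \<in> vs2.span D" using D(4) by blast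
    then obtain c where c: "f v = (\<Sum>y\<in>D. s2 (c y) y)"
      unfolding vs2.span_finite[OF D(2)] by auto
    define v' where "v' = (\<Sum>x\<in>C. s1 (c (f x)) x)"
    have "v' \<in> V" "f v' = (\<Sum>x\<in>C. s2 (c (f x)) (f x))"
      unfolding v'_def using sum[OF C(2,1)] by auto
    moreover have "(\<Sum>x\<in>C. s2 (c (f x)) (f x)) = (\<Sum>y\<in>D. s2 (c y) y)"
      unfolding C_def using inj g by (simp add: sum.reindex)
    ultimately have "f v' = f v" using c by simp
    have "v - v' \<in> V"
      using v \<open>v' \<in> V\<close> by (rule vs1.subspace_diff[OF V])
    moreover have "f (v - v') = 0"
      using add[OF \<open>v - v' \<in> V\<close> \<open>v' \<in> V\<close>] \<open>f v' = f v\<close> by simp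
    ultimately have "v - v' \<in> vs1.span A" using A(4) by blast
    then have "v - v' \<in> vs1.span (A \<union> C)"
      using vs1.span_mono[of A "A \<union> C"] by blast
    moreover have "v' \<in> vs1.span (A \<union> C)"
      unfolding v'_def by (intro vs1.span_sum vs1.span_scale vs1.span_base) auto
    ultimately show "v \<in> vs1.span (A \<union> C)"
      using vs1.span_add by fastforce
  qed
  moreover have "card (A \<union> C) = k + r"
    using A(2,5) C(2,3) disj by (simp add: card_Un_disjoint)
  ultimately show ?thesis
    unfolding vs1.has_dim_def using A(1,2) C(1,2) by (intro exI[of _ "A \<union> C"]) auto
qed

end

section \<open>Polynomials and graded free modules as vector spaces over the ground field\<close>

abbreviation poly_scale :: "'k::field \<Rightarrow> ('v, 'k) mpoly \<Rightarrow> ('v, 'k) mpoly" where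
  "poly_scale c f \<equiv> Const c * f"

abbreviation free_poly_scale :: "'k::field \<Rightarrow> ('b \<Rightarrow>\<^sub>0 ('v, 'k) mpoly) \<Rightarrow> ('b \<Rightarrow>\<^sub>0 ('v, 'k) mpoly)" where
  "free_poly_scale c u \<equiv> free_scale (Const c) u"

lemma lookup_free_scale: "lookup (free_scale r u) b = r * lookup u b"
  by (simp add: free_scale_def Poly_Mapping.map.rep_eq when_def)

lemma vector_space_poly: "vector_space poly_scale"
  by unfold_locales (simp_all add: ring_homD[OF ring_hom_Const] algebra_simps)

lemma vector_space_free: "vector_space free_poly_scale"
  by unfold_locales
    (auto intro!: poly_mapping_eqI simp: lookup_free_scale lookup_add ring_homD[OF ring_hom_Const] algebra_simps)

interpretation polys: vector_space poly_scale
  by (rule vector_space_poly)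

interpretation frees: vector_space free_poly_scale
  by (rule vector_space_free)

interpretation poly_poly: vector_space_pair poly_scale poly_scale ..

interpretation free_poly: vector_space_pair free_poly_scale poly_scale ..

interpretation free_free: vector_space_pair free_poly_scale free_poly_scale ..

lemma subspace_free_module:
  assumes "\<And>d. polys.subspace (R d)"
  shows "frees.subspace (free_module R i S d)"
proof (rule frees.subspaceI)
  show "0 \<in> free_module R i S d"
    using assms[THEN polys.subspace_0] by (auto simp: free_module_def)
next
  fix u v assume "u \<in> free_module R i S d" "v \<in> free_module R i S d"
  then show "u + v \<in> free_module R i S d"
    using keys_add[of u v] assms[THEN polys.subspace_add]
    by (auto simp: free_module_def lookup_add split: if_splits)
next
  fix c u assume "u \<in> free_module R i S d"
  then show "free_poly_scale c u \<in> free_module R i S d"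
    using assms[THEN polys.subspace_scale]
    by (auto simp: free_module_def lookup_free_scale in_keys_iff split: if_splits)
qed

text \<open>The coordinate at a new basis element maps onto \<open>R (d - i)\<close>, and its kernel
  is the free module on the remaining ones.\<close>

lemma has_dim_free_module:
  fixes S :: "'b set"
  assumes sub: "\<And>d. polys.subspace (R d)" and h: "polys.has_dim (R (d - i)) h"
    and S: "finite S" and "i \<le> d"
  shows "frees.has_dim (free_module R i S d) (card S * h)"
  using S
proof (induction S)
  case empty
  have "free_module R i ({} :: 'b set) d = {0}"
    using sub[THEN polys.subspace_0] by (auto simp: free_module_def)
  then show ?case using frees.has_dim_zero by simp
next
  case (insert b S)
  let ?V = "free_module R i (insert b S) d"
  have "{u \<in> ?V. lookup u b = 0} = free_module R i S d"
    using insert(2) by (auto simp: free_module_def in_keys_iff)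
  moreover have "(\<lambda>u. lookup u b) ` ?V = R (d - i)"
  proof
    show "(\<lambda>u. lookup u b) ` ?V \<subseteq> R (d - i)"
      using \<open>i \<le> d\<close> by (auto simp: free_module_def)
    show "R (d - i) \<subseteq> (\<lambda>u. lookup u b) ` ?V"
    proof
      fix x assume "x \<in> R (d - i)"
      then have "single b x \<in> ?V"
        using \<open>i \<le> d\<close> sub[THEN polys.subspace_0] by (auto simp: free_module_def lookup_single when_def)
      then show "x \<in> (\<lambda>u. lookup u b) ` ?V" by (rule rev_image_eqI) simp
    qed
  qed
  ultimately have "frees.has_dim ?V (card S * h + h)"
    using insert(3) h subspace_free_module[OF sub]
    by (intro free_poly.has_dim_kernel_image[where f = "\<lambda>u. lookup u b"]) (auto simp: lookup_add lookup_free_scale)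
  then show ?case using insert(1,2) by (simp add: add.commute)
qed

section \<open>Linear free resolutions and the Hilbert function\<close>

text \<open>\<open>direct_sum\<close> merely collects finite sums of homogeneous elements. This
  property says that the sum is direct, in the form in which it is applied.\<close>

definition graded_independent :: "(nat \<Rightarrow> 'm::ab_group_add set) \<Rightarrow> bool" where
  "graded_independent N \<longleftrightarrow> (\<forall>D u d. finite D \<longrightarrow> (\<forall>e\<in>D. u e \<in> N e) \<longrightarrow>
     (\<Sum>e\<in>D. u e) \<in> N d \<longrightarrow> (\<Sum>e\<in>D. u e) = (if d \<in> D then u d else 0))"

lemma direct_sumI: "u \<in> M d \<Longrightarrow> u \<in> direct_sum M"
  unfolding direct_sum_def by (rule CollectI, rule exI[of _ "{d}"]) auto

lemma graded_hom_direct_sum: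
  assumes "graded_hom R sM M sN N \<phi>" "finite D" "\<forall>e\<in>D. u e \<in> M e" "\<phi> 0 = 0"
  shows "\<phi> (\<Sum>e\<in>D. u e) = (\<Sum>e\<in>D. \<phi> (u e))"
  using assms(2,3)
proof (induction D)
  case empty
  then show ?case using assms(4) by simp
next
  case (insert x D)
  have "u x \<in> direct_sum M" using insert.prems by (auto intro: direct_sumI)
  moreover have "(\<Sum>e\<in>D. u e) \<in> direct_sum M"
    using insert unfolding direct_sum_def by blast
  ultimately have "\<phi> (u x + (\<Sum>e\<in>D. u e)) = \<phi> (u x) + \<phi> (\<Sum>e\<in>D. u e)"
    using assms(1) unfolding graded_hom_def by blast
  then show ?case using insert by simp
qed

text \<open>Exactness is stated for total modules. Since \<open>\<phi>\<close> preserves degrees,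
  the components of a preimage outside degree \<open>d\<close> together contribute nothing, so a
  homogeneous preimage exists.\<close>

lemma graded_hom_image_component:
  assumes hom: "graded_hom R sM M sN N \<phi>" and N: "graded_independent N"
    and zero: "\<And>d. 0 \<in> M d"
    and x: "x \<in> direct_sum M" "\<phi> x \<in> N d"
  shows "\<exists>x'\<in>M d. \<phi> x' = \<phi> x"
proof -
  have "0 \<in> direct_sum M" using zero by (rule direct_sumI)
  then have "\<phi> (0 + 0) = \<phi> 0 + \<phi> 0"
    using hom unfolding graded_hom_def by blast
  then have \<phi>0: "\<phi> 0 = 0" by simp
  from x(1) obtain D u where D: "finite D" "\<forall>e\<in>D. u e \<in> M e" "x = (\<Sum>e\<in>D. u e)"
    unfolding direct_sum_def by blast
  have eq: "\<phi> x = (\<Sum>e\<in>D. \<phi> (u e))"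
    unfolding D(3) by (rule graded_hom_direct_sum[OF hom D(1,2) \<phi>0])
  moreover have "\<forall>e\<in>D. \<phi> (u e) \<in> N e"
    using D(2) hom unfolding graded_hom_def by blast
  ultimately have "\<phi> x = (if d \<in> D then \<phi> (u d) else 0)"
    using N D(1) x(2) unfolding graded_independent_def by metis
  then show ?thesis
    using D(2) zero \<phi>0 by (metis (full_types))
qed

text \<open>\<open>\<delta>\<close> reads the degree of a polynomial off any of its monomials, so
  the coefficient at a basis element \<open>b\<close> and a monomial \<open>m\<close> can be nonzero
  in degree \<open>i + \<delta> m\<close> only.\<close>

lemma graded_independent_free_module:
  assumes deg: "\<And>d f m. f \<in> R d \<Longrightarrow> m \<in> keys f \<Longrightarrow> \<delta> m = d"
  shows "graded_independent (free_module R i S)"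
  unfolding graded_independent_def
proof (intro allI impI)
  fix D u d assume D: "finite D" "\<forall>e\<in>D. u e \<in> free_module R i S e"
    and d: "(\<Sum>e\<in>D. u e) \<in> free_module R i S d"
  have deg': "i + \<delta> m = e" if "v \<in> free_module R i S e" "lookup (lookup v b) m \<noteq> 0" for v e b m
  proof -
    have "lookup v b \<in> (if i \<le> e then R (e - i) else {0})"
      using that(1) by (simp add: free_module_def)
    then show ?thesis
      using that(2) deg[of "lookup v b" "e - i" m] by (auto simp: in_keys_iff split: if_splits)
  qed
  show "(\<Sum>e\<in>D. u e) = (if d \<in> D then u d else 0)"
  proof (intro poly_mapping_eqI)
    fix b m
    have L: "lookup (lookup (\<Sum>e\<in>D. u e) b) m = (\<Sum>e\<in>D. lookup (lookup (u e) b) m)"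
      by (simp add: lookup_sum)
    show "lookup (lookup (\<Sum>e\<in>D. u e) b) m = lookup (lookup (if d \<in> D then u d else 0) b) m"
    proof (cases "i + \<delta> m = d")
      case True
      have "(\<Sum>e\<in>D. lookup (lookup (u e) b) m) = (\<Sum>e\<in>D. if e = d then lookup (lookup (u d) b) m else 0)"
      proof (rule sum.cong)
        fix e assume "e \<in> D"
        then show "lookup (lookup (u e) b) m = (if e = d then lookup (lookup (u d) b) m else 0)"
          using deg'[of "u e" e b m] D(2) True by (cases "e = d") auto
      qed simp
      then show ?thesis using D(1) L by simp
    next
      case False
      then have "lookup (lookup (\<Sum>e\<in>D. u e) b) m = 0"
        using deg'[OF d] by blast
      moreover have "lookup (lookup (if d \<in> D then u d else 0) b) m = 0"
        using deg'[of "u d" d b m] False D(2) by auto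
      ultimately show ?thesis by simp
    qed
  qed
qed

lemma graded_independent_residue_module: "graded_independent (residue_module R)"
  unfolding graded_independent_def
proof (intro allI impI)
  fix D u d assume D: "finite D" "\<forall>e\<in>D. u e \<in> residue_module R e"
    and d: "(\<Sum>e\<in>D. u e) \<in> residue_module R d"
  have "(\<Sum>e\<in>D. u e) = (\<Sum>e\<in>D. if e = 0 then u 0 else 0)"
    using D(2) by (intro sum.cong) (auto simp: residue_module_def)
  also have "\<dots> = (if 0 \<in> D then u 0 else 0)"
    using D(1) by simp
  finally show "(\<Sum>e\<in>D. u e) = (if d \<in> D then u d else 0)"
    using d D(2) by (cases "d = 0") (auto simp: residue_module_def)
qed

text \<open>With this, \<open>residue_scale\<close> by a constant is ordinary multiplication, so
  \<open>\<epsilon>\<close> is linear over the ground field.\<close>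

lemma augmentation_Const:
  assumes deg: "\<And>d f m. f \<in> R d \<Longrightarrow> m \<in> keys f \<Longrightarrow> \<delta> m = (d::nat)"
    and R0: "R 0 = range Const" and sub: "polys.subspace (R 0)"
  shows "augmentation R (Const c) = Const c"
  unfolding augmentation_def
proof (rule the_equality)
  show "Const c \<in> R 0 \<and> Const c - Const c \<in> direct_sum (\<lambda>d. if d = 0 then {0} else R d)"
    unfolding R0 by (auto intro: direct_sumI[of _ _ 0])
  fix c' assume c': "c' \<in> R 0 \<and> Const c - c' \<in> direct_sum (\<lambda>d. if d = 0 then {0} else R d)"
  then obtain D u where D: "Const c - c' = (\<Sum>d\<in>D. u d)" "\<forall>d\<in>D. u d \<in> (if d = 0 then {0} else R d)"
    unfolding direct_sum_def by blast
  have "Const c - c' \<in> R 0"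
    using polys.subspace_diff[OF sub, of "Const c" c'] c' R0 by simp
  have "lookup (Const c - c') m = 0" for m
  proof (cases "\<delta> m = 0")
    case True
    have "lookup (u d) m = 0" if "d \<in> D" for d
      using D(2)[rule_format, OF that] True deg[of "u d" d m] by (cases "d = 0") (auto simp: in_keys_iff)
    then show ?thesis by (simp add: D(1) lookup_sum)
  next
    case False
    then show ?thesis
      using deg[OF \<open>Const c - c' \<in> R 0\<close>, of m] by (auto simp: in_keys_iff)
  qed
  then have "Const c - c' = 0" by (intro poly_mapping_eqI) simp
  then show "c' = Const c" by simp
qed

lemma linear_free_resolution_hilbert:
  fixes R :: "nat \<Rightarrow> ('v, 'k::field) mpoly set" and B :: "nat \<Rightarrow> 'b set"
  assumes sub: "\<And>d. polys.subspace (R d)"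
    and deg: "\<And>d f m. f \<in> R d \<Longrightarrow> m \<in> keys f \<Longrightarrow> \<delta> m = d"
    and R0: "R 0 = range Const"
    and H: "\<And>d. polys.has_dim (R d) (H d)" and H0: "H 0 = 1"
    and res: "linear_free_resolution R B \<epsilon> \<phi>"
  shows "card (B 0) = 1"
    and "0 < d \<Longrightarrow> (\<Sum>i\<le>d. (-1) ^ i * int (card (B i) * H (d - i))) = 0"
proof -
  define F where "F i = free_module R i (B i)" for i
  define Z where "Z i d = {u \<in> F i d. (case i of 0 \<Rightarrow> \<epsilon> u = 0 | Suc j \<Rightarrow> \<phi> j u = 0)}" for i d
  from res have eps: "graded_hom R free_scale (F 0) (residue_scale R) (residue_module R) \<epsilon>"
    and phi: "\<And>i. graded_hom R free_scale (F (Suc i)) free_scale (F i) (\<phi> i)"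
    and ex_eps: "\<epsilon> ` direct_sum (F 0) = direct_sum (residue_module R)"
    and ex_0: "\<phi> 0 ` direct_sum (F 1) = {u \<in> direct_sum (F 0). \<epsilon> u = 0}"
    and ex_Suc: "\<And>i. \<phi> (Suc i) ` direct_sum (F (Suc (Suc i))) = {u \<in> direct_sum (F (Suc i)). \<phi> i u = 0}"
    unfolding linear_free_resolution_def Let_def F_def by auto
  have F_sub: "frees.subspace (F i d)" for i d
    unfolding F_def by (rule subspace_free_module[OF sub])
  have F_zero: "0 \<in> F i d" for i d
    by (rule frees.subspace_0[OF F_sub])
  have F_ind: "graded_independent (F i)" for i
    unfolding F_def by (rule graded_independent_free_module[OF deg])
  have F_large: "F i d = {0}" if "d < i" for i d
  proof
    show "F i d \<subseteq> {0}"
    proof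
      fix u assume "u \<in> F i d"
      then have "lookup u b = 0" for b
        using that by (simp add: F_def free_module_def)
      then show "u \<in> {0}" by (auto intro: poly_mapping_eqI)
    qed
  qed (use F_zero in auto)
  have Const_R: "Const c \<in> direct_sum R" for c
    by (rule direct_sumI[of _ R 0]) (simp add: R0)

  have phi_add: "\<phi> i (u + v) = \<phi> i u + \<phi> i v" if "u \<in> F (Suc i) d" "v \<in> F (Suc i) d" for i d u v
    using phi[of i] direct_sumI[of _ "F (Suc i)"] that unfolding graded_hom_def by blast
  have phi_scale: "\<phi> i (free_poly_scale c u) = free_poly_scale c (\<phi> i u)" if "u \<in> F (Suc i) d" for i d u c
    using phi[of i] direct_sumI[of _ "F (Suc i)"] that Const_R unfolding graded_hom_def by blast
  have phi_zero: "\<phi> i 0 = 0" for i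
    using phi_add[OF F_zero F_zero, of i] by simp
  have eps_add: "\<epsilon> (u + v) = \<epsilon> u + \<epsilon> v" if "u \<in> F 0 d" "v \<in> F 0 d" for d u v
    using eps direct_sumI[of _ "F 0"] that unfolding graded_hom_def by blast
  have eps_scale: "\<epsilon> (free_poly_scale c u) = poly_scale c (\<epsilon> u)" if "u \<in> F 0 d" for d u c
  proof -
    have "\<epsilon> (free_poly_scale c u) = residue_scale R (Const c) (\<epsilon> u)"
      using eps direct_sumI[of _ "F 0"] that Const_R unfolding graded_hom_def by blast
    then show ?thesis
      by (simp add: residue_scale_def augmentation_Const[of R \<delta>, OF deg R0 sub])
  qed
  have eps_degree: "\<epsilon> u \<in> residue_module R d" if "u \<in> F 0 d" for u d
    using eps that unfolding graded_hom_def by blast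

  have ex_direct: "\<phi> i ` direct_sum (F (Suc i)) =
      {u \<in> direct_sum (F i). (case i of 0 \<Rightarrow> \<epsilon> u = 0 | Suc j \<Rightarrow> \<phi> j u = 0)}" for i
    by (cases i) (use ex_0 ex_Suc in auto)
  have exact: "\<phi> i ` F (Suc i) d = Z i d" for i d
  proof
    show "\<phi> i ` F (Suc i) d \<subseteq> Z i d"
    proof
      fix y assume "y \<in> \<phi> i ` F (Suc i) d"
      then obtain x where x: "x \<in> F (Suc i) d" "y = \<phi> i x" by blast
      then have "y \<in> F i d" using phi[of i] unfolding graded_hom_def by blast
      moreover have "y \<in> \<phi> i ` direct_sum (F (Suc i))" using x by (auto intro: direct_sumI)
      ultimately show "y \<in> Z i d" unfolding ex_direct Z_def by simp
    qed
    show "Z i d \<subseteq> \<phi> i ` F (Suc i) d"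
    proof
      fix y assume y: "y \<in> Z i d"
      then have "y \<in> \<phi> i ` direct_sum (F (Suc i))"
        unfolding ex_direct Z_def by (auto intro: direct_sumI)
      then obtain x where x: "x \<in> direct_sum (F (Suc i))" "y = \<phi> i x" by blast
      have "\<phi> i x \<in> F i d" using y x(2) by (simp add: Z_def)
      then have "\<exists>x'\<in>F (Suc i) d. \<phi> i x' = \<phi> i x"
        by (rule graded_hom_image_component[OF phi F_ind F_zero x(1)])
      then show "y \<in> \<phi> i ` F (Suc i) d"
        unfolding x(2) by (metis imageI)
    qed
  qed
  \<comment> \<open>Linearity enters here: \<open>F (Suc d)\<close> is zero in degree
    \<open>d\<close>, hence so is the image of \<open>\<phi> d\<close>.\<close>
  have Z_diag: "Z d d = {0}" for d
    using exact[of d d] by (simp add: F_large phi_zero)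
  have dim_sum: "frees.has_dim W (k + r)"
    if "frees.subspace W" "W \<subseteq> F (Suc i) d" "frees.has_dim {u \<in> W. \<phi> i u = 0} k" "frees.has_dim (\<phi> i ` W) r"
    for W i d k r
    by (rule free_free.has_dim_kernel_image[where f = "\<phi> i"])
      (use that in \<open>auto intro: phi_add phi_scale\<close>)
  have eps_0: "\<epsilon> ` F 0 0 = R 0"
  proof
    show "\<epsilon> ` F 0 0 \<subseteq> R 0" using eps_degree[of _ 0] by (auto simp: residue_module_def)
    show "R 0 \<subseteq> \<epsilon> ` F 0 0"
    proof
      fix y assume "y \<in> R 0"
      then have y: "y \<in> residue_module R 0" by (simp add: residue_module_def)
      then have "y \<in> \<epsilon> ` direct_sum (F 0)" unfolding ex_eps by (rule direct_sumI)
      then obtain x where x: "x \<in> direct_sum (F 0)" "y = \<epsilon> x" by blast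
      have "\<exists>x'\<in>F 0 0. \<epsilon> x' = \<epsilon> x"
        by (rule graded_hom_image_component[OF eps graded_independent_residue_module F_zero x(1)])
          (use x(2) y in simp)
      then show "y \<in> \<epsilon> ` F 0 0"
        unfolding x(2) by (metis imageI)
    qed
  qed
  have F00: "frees.has_dim (F 0 0) 1"
  proof -
    have "{u \<in> F 0 0. \<epsilon> u = 0} = {0}"
      using Z_diag[of 0] by (simp add: Z_def)
    then have "frees.has_dim (F 0 0) (0 + 1)"
      using H[of 0] H0 frees.has_dim_zero F_sub
      by (intro free_poly.has_dim_kernel_image[where f = \<epsilon>]) (auto simp: eps_0 intro: eps_add eps_scale)
    then show ?thesis by simp
  qed

  have S_dim: "frees.has_dim (free_module R i S i) (card S)" if "finite S" for i S
    using has_dim_free_module[of R i i, OF sub H that] H0 by simp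
  have S_sub: "free_module R i S d \<subseteq> F i d" if "S \<subseteq> B i" for i S d
    using that by (auto simp: F_def free_module_def)
  \<comment> \<open>By \<open>Z_diag\<close>, the part of \<open>F (Suc i)\<close> in its generating
    degree embeds into \<open>F i (Suc i)\<close>, which is finite-dimensional by induction. This
    bounds the size of finite subsets of the basis.\<close>
  have fin: "finite (B i)" for i
  proof (induction i)
    case 0
    have "card S \<le> 1" if "S \<subseteq> B 0" "finite S" for S
      using frees.has_dim_subset[OF F00 S_sub[OF that(1)]] frees.has_dim_unique[OF S_dim[OF that(2)]] by blast
    then show ?case using finite_if_finite_subsets_card_bdd by blast
  next
    case (Suc i)
    define n where "n = card (B i) * H 1"
    have n: "frees.has_dim (F i (Suc i)) n"
      unfolding n_def F_def using has_dim_free_module[of R "Suc i" i, OF sub H Suc] by simp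
    have "card S \<le> n" if S: "S \<subseteq> B (Suc i)" "finite S" for S
    proof -
      let ?W = "free_module R (Suc i) S (Suc i)"
      have "\<phi> i ` ?W \<subseteq> F i (Suc i)"
        using exact[of i "Suc i"] S_sub[OF S(1), of "Suc i"] by (auto simp: Z_def)
      then obtain m where m: "m \<le> n" "frees.has_dim (\<phi> i ` ?W) m"
        using frees.has_dim_subset[OF n] by blast
      have "{u \<in> ?W. \<phi> i u = 0} = {0}"
        using Z_diag[of "Suc i"] S_sub[OF S(1), of "Suc i"] frees.subspace_0[OF subspace_free_module[OF sub]] phi_zero
        by (auto simp: Z_def)
      then have "frees.has_dim ?W (0 + m)"
        using m(2) frees.has_dim_zero by (intro dim_sum[OF subspace_free_module[OF sub] S_sub[OF S(1)]]) simp_all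
      then show ?thesis
        using frees.has_dim_unique[OF S_dim[OF S(2)]] m(1) by simp
    qed
    then show ?case using finite_if_finite_subsets_card_bdd by blast
  qed
  show "card (B 0) = 1"
    using frees.has_dim_unique[OF S_dim[OF fin] F00[unfolded F_def]] .

  assume "0 < d"
  define n where "n i = card (B i) * H (d - i)" for i
  have n: "frees.has_dim (F i d) (n i)" if "i \<le> d" for i
    unfolding n_def F_def by (rule has_dim_free_module[OF sub H fin that])
  have "frees.has_dim (Z 0 d) (n 0)"
  proof -
    have "Z 0 d = F 0 d"
      using eps_degree[of _ d] \<open>0 < d\<close> by (auto simp: Z_def residue_module_def)
    then show ?thesis using n[of 0] by simp
  qed
  \<comment> \<open>\<open>\<phi> i\<close> maps \<open>F (Suc i) d\<close> onto
    \<open>Z i d\<close> with kernel \<open>Z (Suc i) d\<close>. The dimensions of consecutive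
    kernels therefore add up to \<open>n (Suc i)\<close>, and the alternating sum
    telescopes.\<close>
  have "\<exists>z. frees.has_dim (Z i d) z \<and> (-1) ^ i * int z = (\<Sum>j\<le>i. (-1) ^ j * int (n j))" if "i \<le> d" for i
    using that
  proof (induction i)
    case 0
    then show ?case using \<open>frees.has_dim (Z 0 d) (n 0)\<close> by auto
  next
    case (Suc i)
    then obtain z where z: "frees.has_dim (Z i d) z" "(-1) ^ i * int z = (\<Sum>j\<le>i. (-1) ^ j * int (n j))"
      by auto
    have "Z (Suc i) d \<subseteq> F (Suc i) d" by (auto simp: Z_def)
    then obtain z' where z': "frees.has_dim (Z (Suc i) d) z'"
      using frees.has_dim_subset[OF n[OF Suc.prems]] by blast
    have "frees.has_dim (F (Suc i) d) (z' + z)"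
      using z' z(1) by (intro dim_sum[OF F_sub subset_refl]) (simp_all add: exact Z_def)
    then have "n (Suc i) = z' + z"
      using frees.has_dim_unique n[OF Suc.prems] by blast
    then have "(-1) ^ Suc i * int z' = (\<Sum>j\<le>Suc i. (-1) ^ j * int (n j))"
      using z(2) by (simp add: algebra_simps)
    then show ?case using z' by blast
  qed
  then obtain z where "frees.has_dim (Z d d) z" "(-1) ^ d * int z = (\<Sum>j\<le>d. (-1) ^ j * int (n j))" by blast
  moreover from this have "z = 0"
    using frees.has_dim_unique[OF _ frees.has_dim_zero] by (simp add: Z_diag)
  ultimately show "(\<Sum>i\<le>d. (-1) ^ i * int (card (B i) * H (d - i))) = 0"
    by (simp add: n_def)
qed

section \<open>The Hilbert function of the invariant ring\<close>

lemma subspace_invariant_ring: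
  fixes w :: "'n \<Rightarrow> nat"
  shows "polys.subspace (invariant_ring w d :: ('n coord, 'k::field) mpoly set)"
proof (rule polys.subspaceI)
  show "0 \<in> invariant_ring w d"
    using SL2_invariant_Const[of 0]
    by (simp add: invariant_ring_def multigraded_piece_def ring_homD[OF ring_hom_Const])
next
  fix f g :: "('n coord, 'k) mpoly" assume "f \<in> invariant_ring w d" "g \<in> invariant_ring w d"
  then show "f + g \<in> invariant_ring w d"
    using keys_add[of f g] by (auto simp: invariant_ring_def multigraded_piece_def intro: SL2_invariant_add)
next
  fix c and f :: "('n coord, 'k) mpoly" assume "f \<in> invariant_ring w d"
  then show "poly_scale c f \<in> invariant_ring w d"
    by (auto simp: invariant_ring_def multigraded_piece_def in_keys_iff lookup_Const_times
        intro: SL2_invariant_mult SL2_invariant_Const)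
qed

lemma invariant_ring_0:
  fixes w :: "'n \<Rightarrow> nat"
  shows "invariant_ring w 0 = range (Const :: 'k::field \<Rightarrow> ('n coord, 'k) mpoly)"
proof
  have "keys (Const c :: ('n coord, 'k) mpoly) \<subseteq> {0}" for c
    by (simp add: Const_def)
  then show "range Const \<subseteq> (invariant_ring w 0 :: ('n coord, 'k) mpoly set)"
    by (fastforce simp: invariant_ring_def multigraded_piece_def SL2_invariant_Const)
  show "invariant_ring w 0 \<subseteq> range (Const :: 'k \<Rightarrow> ('n coord, 'k) mpoly)"
  proof
    fix f :: "('n coord, 'k) mpoly" assume f: "f \<in> invariant_ring w 0"
    have key: "m = 0" if "m \<in> keys f" for m
      using f that by (intro coord_monomial_eqI) (auto simp: invariant_ring_def multigraded_piece_def)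
    have "f = Const (lookup f 0)"
    proof (rule poly_mapping_eqI)
      fix m show "lookup f m = lookup (Const (lookup f 0)) m"
        using key[of m] by (auto simp: Const_def lookup_single when_def in_keys_iff)
    qed
    then show "f \<in> range Const" by blast
  qed
qed

section \<open>Ballot lists and their monomials\<close>

lemma ballot_le: "ballot d h as \<Longrightarrow> set as \<subseteq> {..d}"
  by (induction as arbitrary: h) auto

lemma finite_ballot: "finite {as. length as = n \<and> ballot d h as}"
proof (rule finite_subset)
  show "{as. length as = n \<and> ballot d h as} \<subseteq> {as. set as \<subseteq> {..d} \<and> length as = n}"
    using ballot_le by blast
qed (rule finite_lists_length_eq, simp)

lemma lookup_path_monomial_notin:
  "j \<notin> set js \<Longrightarrow> lookup (path_monomial d js as) (X j) = 0 \<and> lookup (path_monomial d js as) (Y j) = 0"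
  by (induction d js as rule: path_monomial.induct) (auto simp: lookup_add lookup_single when_def)

lemma inj_path_monomial:
  assumes "distinct js" "length as = length js" "length as' = length js"
    and "path_monomial d js as = path_monomial d js as'"
  shows "as = as'"
  using assms
proof (induction js arbitrary: as as')
  case (Cons j js)
  obtain a bs where as: "as = a # bs" using Cons.prems by (cases as) auto
  obtain a' bs' where as': "as' = a' # bs'" using Cons.prems by (cases as') auto
  have "lookup (path_monomial d (j # js) (c # cs)) (X j) = c" for c cs
    using lookup_path_monomial_notin[of j js d cs] Cons.prems(1) by (simp add: lookup_add lookup_single)
  then have "a = a'"
    using Cons.prems(4) unfolding as as' by metis
  moreover have "bs = bs'"
    by (rule Cons.IH) (use Cons.prems \<open>a = a'\<close> in \<open>auto simp: as as'\<close>)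
  ultimately show ?case by (simp add: as as')
qed simp

lemma coldeg_path_monomial:
  assumes "distinct js" "length as = length js" "set as \<subseteq> {..d}"
  shows "coldeg (path_monomial d js as) i = (if i \<in> set js then d else 0)"
  using assms
proof (induction js arbitrary: as)
  case Nil
  then show ?case by (simp add: coldeg_def)
next
  case (Cons j js)
  obtain a bs where as: "as = a # bs" using Cons.prems by (cases as) auto
  have "coldeg (path_monomial d js bs) i = (if i \<in> set js then d else 0)"
    by (rule Cons.IH) (use Cons.prems in \<open>auto simp: as\<close>)
  moreover have "coldeg (single (X j) a + single (Y j) (d - a)) i = (if i = j then d else 0)"
    using Cons.prems(3) by (auto simp: coldeg_def as lookup_add lookup_single when_def)
  ultimately show ?case
    using Cons.prems(1) by (auto simp: as coldeg_add)
qed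

section \<open>Triangularity of the bracket products\<close>

lemma exists_decreasing_weight:
  "distinct js \<Longrightarrow> \<exists>w :: 'n \<Rightarrow> nat. sorted_wrt (\<lambda>i j. w j < w i) js"
proof (induction js)
  case (Cons j js)
  then obtain w :: "'n \<Rightarrow> nat" where w: "sorted_wrt (\<lambda>i j. w j < w i) js" by auto
  define w' where "w' = w(j := Suc (\<Sum>i\<leftarrow>js. w i))"
  have "sorted_wrt (\<lambda>i j. w' j < w' i) js"
    using w by (rule sorted_wrt_mono_rel[rotated]) (use Cons.prems in \<open>auto simp: w'_def\<close>)
  moreover have "w' i < w' j" if "i \<in> set js" for i
    using member_le_sum_list[of "w i" "map w js"] that Cons.prems by (auto simp: w'_def less_Suc_eq_le)
  ultimately show ?case by auto
qed simp

lemma leading_invariant_lookup: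
  assumes "leading_invariant w f m"
  shows "lookup f m = 1" and "k \<in> keys f \<Longrightarrow> k \<noteq> m \<Longrightarrow> xweight w k < xweight w m"
    and "k \<in> keys f \<Longrightarrow> coldeg k = coldeg m"
proof -
  obtain g where g: "f = single m 1 + g" "\<And>k. k \<in> keys g \<Longrightarrow> xweight w k < xweight w m \<and> coldeg k = coldeg m"
    using assms unfolding leading_invariant_def by blast
  have "m \<notin> keys g" using g(2) by blast
  then show "lookup f m = 1" by (simp add: g(1) lookup_add in_keys_iff)
  have "k \<in> keys g" if "k \<in> keys f" "k \<noteq> m" for k
    using that by (auto simp: g(1) in_keys_iff lookup_add lookup_single)
  then show "k \<in> keys f \<Longrightarrow> k \<noteq> m \<Longrightarrow> xweight w k < xweight w m" "k \<in> keys f \<Longrightarrow> coldeg k = coldeg m"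
    using g(2) by blast+
qed

lemma independent_leading_invariants:
  fixes F :: "('n::finite coord \<Rightarrow>\<^sub>0 nat) \<Rightarrow> ('n coord, 'k::field) mpoly"
  assumes A: "finite A" and F: "\<And>m. m \<in> A \<Longrightarrow> leading_invariant w (F m) m"
  shows "inj_on F A" "polys.independent (F ` A)"
proof -
  have lookup_F: "lookup (F m) m = 1" if "m \<in> A" for m
    by (rule leading_invariant_lookup(1)[OF F[OF that]])
  have weight_F: "xweight w k < xweight w m" if "m \<in> A" "lookup (F m) k \<noteq> 0" "k \<noteq> m" for m k
    by (rule leading_invariant_lookup(2)[OF F[OF that(1)]]) (use that in \<open>simp_all add: in_keys_iff\<close>)
  show inj: "inj_on F A"
  proof (rule inj_onI, rule ccontr)
    fix m m' assume "m \<in> A" "m' \<in> A" "F m = F m'" "m \<noteq> m'"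
    then show False
      using weight_F[of m m'] weight_F[of m' m] lookup_F[of m] lookup_F[of m'] by simp
  qed
  show "polys.independent (F ` A)"
  proof (rule polys.independent_if_scalars_zero)
    show "finite (F ` A)" using A by simp
    fix c x assume *: "(\<Sum>x\<in>F ` A. poly_scale (c x) x) = 0" and x: "x \<in> F ` A"
    show "c x = 0"
    proof (rule ccontr)
      assume "c x \<noteq> 0"
      \<comment> \<open>Take \<open>m\<close> of largest weight among the indices with nonzero
        coefficient. Any other \<open>F m'\<close> containing the monomial \<open>m\<close> has
        \<open>m'\<close> of larger weight, so the relation has coefficient \<open>c (F m)\<close>
        at \<open>m\<close>.\<close>
      define M where "M = {m \<in> A. c (F m) \<noteq> 0}"
      have M: "finite M" "M \<noteq> {}" using A x \<open>c x \<noteq> 0\<close> by (auto simp: M_def)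
      then have "Max (xweight w ` M) \<in> xweight w ` M" by (intro Max_in) auto
      then obtain m where m: "m \<in> M" "xweight w m = Max (xweight w ` M)" by auto
      have max: "xweight w m' \<le> xweight w m" if "m' \<in> M" for m'
        unfolding m(2) using that M by (intro Max_ge) auto
      have "0 = lookup (\<Sum>x\<in>F ` A. poly_scale (c x) x) m" using * by simp
      also have "\<dots> = (\<Sum>m'\<in>A. c (F m') * lookup (F m') m)"
        using inj by (simp add: sum.reindex lookup_sum lookup_Const_times)
      also have "\<dots> = (\<Sum>m'\<in>A. if m' = m then c (F m) else 0)"
      proof (rule sum.cong)
        fix m' assume m': "m' \<in> A"
        show "c (F m') * lookup (F m') m = (if m' = m then c (F m) else 0)"
        proof (cases "m' = m")
          case True
          then show ?thesis using lookup_F[OF m'] by simp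
        next
          case False
          then have "lookup (F m') m = 0 \<or> m' \<notin> M"
            using weight_F[OF m', of m] max[of m'] by fastforce
          then show ?thesis using False m' by (auto simp: M_def)
        qed
      qed simp
      also have "\<dots> = c (F m)" using m(1) A by (simp add: M_def)
      finally show False using m(1) by (simp add: M_def)
    qed
  qed
qed

text \<open>The ballot condition refers to an order of the points. Any enumeration \<open>js\<close>
  will do, and the weight is chosen decreasing along it, so that both bounds concern the same
  monomials \<open>A\<close>.\<close>

lemma has_dim_invariant_ring:
  "polys.has_dim (invariant_ring (\<lambda>_. 1) d :: ('n::finite coord, 'k::field) mpoly set)
    (card {as. length as = CARD('n) \<and> ballot d 0 as})"
proof -
  define V where "V = (invariant_ring (\<lambda>_. 1) d :: ('n coord, 'k) mpoly set)"
  define P where "P = {as. length as = CARD('n) \<and> ballot d 0 as}"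
  obtain js :: "'n list" where js: "set js = UNIV" "distinct js"
    using finite_distinct_list[OF finite_class.finite_UNIV] by blast
  then have len: "length js = CARD('n)" by (metis distinct_card)
  obtain w :: "'n \<Rightarrow> nat" where w: "sorted_wrt (\<lambda>i j. w j < w i) js"
    using exists_decreasing_weight[OF js(2)] by blast
  define A where "A = path_monomial d js ` P"
  have finP: "finite P" unfolding P_def by (rule finite_ballot)
  then have finA: "finite A" by (simp add: A_def)
  have "inj_on (path_monomial d js) P"
    by (rule inj_onI, rule inj_path_monomial[OF js(2)]) (auto simp: P_def len)
  then have cardA: "card A = card P"
    unfolding A_def by (rule card_image)

  \<comment> \<open>\<open>T\<close> discards all terms that are not ballot monomials. Its
    injectivity on \<open>V\<close> turns the existence of a ballot monomial into a bound on the
    dimension.\<close>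
  define T where "T f = (\<Sum>m\<in>A. single m (lookup f m))" for f :: "('n coord, 'k) mpoly"
  have lookup_T: "lookup (T f) m = (if m \<in> A then lookup f m else 0)" for f m
  proof -
    have "lookup (T f) m = (\<Sum>k\<in>A. if k = m then lookup f m else 0)"
      unfolding T_def lookup_sum by (intro sum.cong) (auto simp: lookup_single when_def)
    then show ?thesis using finA by simp
  qed
  have "T f \<in> polys.span ((\<lambda>m. single m 1) ` A)" for f
  proof -
    have "T f = (\<Sum>m\<in>A. poly_scale (lookup f m) (single m 1))"
      by (simp add: T_def Const_def mult_single)
    also have "\<dots> \<in> polys.span ((\<lambda>m. single m 1) ` A)"
      by (intro polys.span_sum polys.span_scale polys.span_base imageI)
    finally show ?thesis .
  qed
  then have "\<exists>n\<le>card ((\<lambda>m. single m 1 :: ('n coord, 'k) mpoly) ` A). polys.has_dim (T ` V) n"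
    using finA by (intro polys.has_dim_of_span) auto
  then obtain n where n: "n \<le> card P" "polys.has_dim (T ` V) n"
    using card_image_le[OF finA] cardA by (metis le_trans)
  have ker: "f = 0" if f: "f \<in> V" "T f = 0" for f
  proof (rule ccontr)
    assume "f \<noteq> 0"
    have inv: "SL2_invariant f" and deg: "\<And>m i. m \<in> keys f \<Longrightarrow> lookup m (X i) + lookup m (Y i) = d"
      using f(1) by (auto simp: V_def invariant_ring_def multigraded_piece_def)
    have "xdeg m + ydeg m = CARD('n) * d" if "m \<in> keys f" for m
      using deg[OF that] by (simp flip: sum.distrib)
    \<comment> \<open>The two degrees agree and sum to \<open>CARD('n) * d\<close>, so the division
      is exact whenever a term exists, and the path starts at height zero.\<close>
    then have "xdeg m = CARD('n) * d div 2 \<and> ydeg m = CARD('n) * d div 2" if "m \<in> keys f" for m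
      using SL2_invariant_xdeg_eq_ydeg[OF inv that] that by fastforce
    then have "\<exists>as. length as = length js \<and> ballot d (CARD('n) * d div 2 - CARD('n) * d div 2) as \<and> path_monomial d js as \<in> keys f"
      by (intro shear_invariant_ballot[OF js(2) SL2_invariant_shear[OF inv] \<open>f \<noteq> 0\<close>]) (use deg js(1) in auto)
    then obtain m where "m \<in> A" "m \<in> keys f"
      by (auto simp: A_def P_def len)
    then show False
      using lookup_T[of f m] f(2) by (auto simp: in_keys_iff)
  qed
  have sub: "polys.subspace V" unfolding V_def by (rule subspace_invariant_ring)
  have "{f \<in> V. T f = 0} = {0}"
    using ker polys.subspace_0[OF sub] by (auto simp: T_def)
  then have "polys.has_dim V (0 + n)"
    using polys.has_dim_zero n(2) sub
    by (intro poly_poly.has_dim_kernel_image[where f = T])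
      (auto intro!: poly_mapping_eqI simp: lookup_T lookup_add lookup_Const_times)
  then have V: "polys.has_dim V n" by simp

  have "\<exists>f :: ('n coord, 'k) mpoly. leading_invariant w f m" if "m \<in> A" for m
    using that exists_ballot_invariant[OF w, of "[]"] by (auto simp: A_def P_def len stack_monomial_def)
  then obtain F :: "_ \<Rightarrow> ('n coord, 'k) mpoly" where F: "\<And>m. m \<in> A \<Longrightarrow> leading_invariant w (F m) m" by metis
  have "F m \<in> V" if "m \<in> A" for m
  proof -
    have "coldeg m i = d" for i
      using that js ballot_le by (force simp: A_def P_def coldeg_path_monomial len)
    then have "coldeg k i = d" if "k \<in> keys (F m)" for k i
      using leading_invariant_lookup(3)[OF F[OF \<open>m \<in> A\<close>] that] by simp
    then show ?thesis
      using F[OF that] by (simp add: V_def invariant_ring_def multigraded_piece_def coldeg_def leading_invariant_def)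
  qed
  then have "F ` A \<subseteq> V" by blast
  then have "card (F ` A) \<le> n"
    using polys.has_dim_independent[OF V] independent_leading_invariants(2)[OF finA F] by blast
  then have "card P \<le> n"
    using independent_leading_invariants(1)[OF finA F] cardA by (simp add: card_image)
  with n(1) V show ?thesis
    by (simp add: V_def P_def)
qed

section \<open>Counting ballot paths\<close>

lemma card_ballot_0: "card {as. length as = 0 \<and> ballot d h as} = (if h = 0 then 1 else 0)"
proof -
  have "{as. length as = 0 \<and> ballot d h as} = (if h = 0 then {[]} else {})" by auto
  then show ?thesis by simp
qed

text \<open>The truncated \<open>d - h\<close> is the least admissible first letter; writing it as
  \<open>d - h + k\<close> gives the new heights \<open>|h - d|, |h - d| + 2, ..., h + d\<close>, as
  in the Clebsch-Gordan rule.\<close>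

lemma card_ballot_Suc:
  "card {as. length as = Suc n \<and> ballot d h as} =
    (\<Sum>k<Suc (d - (d - h)). card {as. length as = n \<and> ballot d (h - d + (d - h) + 2 * k) as})"
proof -
  have "{as. length as = Suc n \<and> ballot d h as} =
    (\<Union>k\<in>{..<Suc (d - (d - h))}. (#) (d - h + k) ` {as. length as = n \<and> ballot d (h - d + (d - h) + 2 * k) as})"
    (is "?L = ?R")
  proof
    show "?L \<subseteq> ?R"
    proof
      fix as assume "as \<in> ?L"
      then obtain a bs where as: "as = a # bs" "length bs = n" "a \<le> d" "d \<le> h + a" "ballot d (h + a + a - d) bs"
        by (cases as) auto
      define k where "k = a - (d - h)"
      have k: "a = d - h + k" "k < Suc (d - (d - h))" "h + a + a - d = h - d + (d - h) + 2 * k"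
        using as(3,4) by (auto simp: k_def)
      show "as \<in> ?R"
        using as(2,5) k(2) unfolding as(1) k(3) by (subst k(1)) blast
    qed
    show "?R \<subseteq> ?L"
    proof
      fix as assume "as \<in> ?R"
      then obtain k bs where as: "k < Suc (d - (d - h))" "as = (d - h + k) # bs" "length bs = n"
          "ballot d (h - d + (d - h) + 2 * k) bs"
        by blast
      have "h + (d - h + k) + (d - h + k) - d = h - d + (d - h) + 2 * k"
        by linarith
      then show "as \<in> ?L" using as by auto
    qed
  qed
  then have "card ?L = card ?R" by (rule arg_cong)
  also have "\<dots> = (\<Sum>k<Suc (d - (d - h)). card ((#) (d - h + k) ` {as. length as = n \<and> ballot d (h - d + (d - h) + 2 * k) as}))"
    by (rule card_UN_disjoint) (auto simp: finite_ballot)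
  also have "\<dots> = (\<Sum>k<Suc (d - (d - h)). card {as. length as = n \<and> ballot d (h - d + (d - h) + 2 * k) as})"
  proof (rule sum.cong[OF refl])
    fix k
    show "card ((#) (d - h + k) ` {as. length as = n \<and> ballot d (h - d + (d - h) + 2 * k) as}) =
        card {as. length as = n \<and> ballot d (h - d + (d - h) + 2 * k) as}"
      by (rule card_image) simp
  qed
  finally show ?thesis .
qed

section \<open>Tabulating the counts by starting height\<close>

definition table_entry :: "int list \<Rightarrow> nat \<Rightarrow> int" where
  "table_entry T h = (if h < length T then T ! h else 0)"

fun evens :: "'a list \<Rightarrow> 'a list" where
  "evens (x # y # xs) = x # evens xs"
| "evens xs = xs"

text \<open>One letter lowers the height by at most \<open>d\<close>, so from height
  \<open>length T + d\<close> on every successor lies beyond the old row and the count is zero.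
  \<open>evens\<close> picks the heights of the right parity.\<close>

definition table_step :: "nat \<Rightarrow> int list \<Rightarrow> int list" where
  "table_step d T =
    map (\<lambda>h. sum_list (take (Suc (d - (d - h))) (evens (drop (h - d + (d - h)) T)))) [0..<length T + d]"

fun ballot_table :: "nat \<Rightarrow> nat \<Rightarrow> int list" where
  "ballot_table d 0 = [1]"
| "ballot_table d (Suc n) = table_step d (ballot_table d n)"

lemma table_entry_simps:
  "table_entry [] k = 0" "table_entry (x # xs) 0 = x" "table_entry (x # xs) (Suc k) = table_entry xs k"
  by (simp_all add: table_entry_def)

lemma table_entry_evens: "table_entry (evens T) k = table_entry T (2 * k)"
proof (induction T arbitrary: k rule: evens.induct)
  case (1 x y xs)
  then show ?case by (cases k) (simp_all add: table_entry_simps)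
next
  case ("2_2" x)
  then show ?case by (cases k) (simp_all add: table_entry_simps)
qed (simp add: table_entry_simps)

lemma table_entry_drop: "table_entry (drop m T) k = table_entry T (m + k)"
  by (auto simp: table_entry_def)

lemma sum_list_take_table_entry: "sum_list (take m T) = (\<Sum>k<m. table_entry T k)"
proof (induction m arbitrary: T)
  case (Suc m)
  then show ?case
    by (cases T) (simp_all add: table_entry_simps sum.lessThan_Suc_shift del: sum.lessThan_Suc)
qed simp

lemma table_entry_ballot:
  "table_entry (ballot_table d n) h = int (card {as. length as = n \<and> ballot d h as})"
proof (induction n arbitrary: h)
  case 0
  show ?case by (simp add: card_ballot_0[simplified] table_entry_def)
next
  case (Suc n)
  let ?T = "ballot_table d n"
  have "table_entry (table_step d ?T) h = sum_list (take (Suc (d - (d - h))) (evens (drop (h - d + (d - h)) ?T)))"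
  proof (cases "h < length ?T + d")
    case True
    then show ?thesis by (simp add: table_step_def table_entry_def)
  next
    case False
    then show ?thesis by (simp add: table_step_def table_entry_def[of "map f xs" for f xs])
  qed
  also have "\<dots> = (\<Sum>k<Suc (d - (d - h)). table_entry ?T (h - d + (d - h) + 2 * k))"
    by (simp only: sum_list_take_table_entry table_entry_evens table_entry_drop)
  finally show ?case
    unfolding card_ballot_Suc by (simp only: Suc ballot_table.simps of_nat_sum)
qed

text \<open>For \<open>d = 1\<close> the value is the Catalan number 14, counting noncrossing
  perfect matchings of eight points.\<close>

lemma int_card_ballot_values:
  "int (card {as. length as = 8 \<and> ballot 0 0 as}) = 1"
  "int (card {as. length as = 8 \<and> ballot 1 0 as}) = 14"
  "int (card {as. length as = 8 \<and> ballot 2 0 as}) = 91"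
  "int (card {as. length as = 8 \<and> ballot 3 0 as}) = 364"
  "int (card {as. length as = 8 \<and> ballot 4 0 as}) = 1085"
  "int (card {as. length as = 8 \<and> ballot 5 0 as}) = 2666"
  "int (card {as. length as = 8 \<and> ballot 6 0 as}) = 5719"
  "int (card {as. length as = 8 \<and> ballot 7 0 as}) = 11096"
  unfolding table_entry_ballot[symmetric] by code_simp+

section \<open>The forced ranks and the contradiction\<close>

theorem mainTheorem5:
  fixes w :: "8 \<Rightarrow> nat"
    and R :: "nat \<Rightarrow> (8 coord, 'k::field) mpoly set"
  assumes "w = (\<lambda>i. 1)"
    and "R = invariant_ring w"
  shows "\<not> koszul TYPE('b) R"
proof
  assume "koszul TYPE('b) R"
  then obtain B :: "nat \<Rightarrow> 'b set" and \<epsilon> \<phi> where res: "linear_free_resolution R B \<epsilon> \<phi>"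
    unfolding koszul_def by blast
  define H where "H d = card {as. length as = 8 \<and> ballot d 0 as}" for d
  have dim: "polys.has_dim (R d) (H d)" for d
    using has_dim_invariant_ring[where ?'n = 8 and ?'k = 'k, of d] by (simp add: assms H_def)
  \<comment> \<open>In degree \<open>d\<close> every column has degree \<open>d\<close>, so column
    \<open>0\<close> alone serves as the degree function \<open>\<delta>\<close>.\<close>
  have deg: "lookup m (X 0) + lookup m (Y 0) = d" if "f \<in> R d" "m \<in> keys f" for d f m
    using that by (auto simp: assms invariant_ring_def multigraded_piece_def)
  have R0: "R 0 = range Const" and sub: "polys.subspace (R d)" for d
    unfolding assms by (rule invariant_ring_0 subspace_invariant_ring)+
  have H: "H 0 = 1" "H 1 = 14" "H 2 = 91" "H 3 = 364" "H 4 = 1085" "H 5 = 2666" "H 6 = 5719" "H 7 = 11096"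
    unfolding H_def using int_card_ballot_values by linarith+
  have "card (B 0) = 1"
    by (rule linear_free_resolution_hilbert(1)[where R = R and H = H and B = B
          and \<delta> = "\<lambda>m. lookup m (X 0) + lookup m (Y 0)"]) (fact sub deg R0 dim H(1) res)+
  moreover have "(\<Sum>i\<le>d. (-1) ^ i * int (card (B i) * H (d - i))) = 0" if "0 < d" for d
    by (rule linear_free_resolution_hilbert(2)[where R = R and H = H and B = B
          and \<delta> = "\<lambda>m. lookup m (X 0) + lookup m (Y 0)"]) (fact sub deg R0 dim H(1) res that)+
  ultimately have hilbert: "card (B 0) = 1"
    "\<And>d. 0 < d \<Longrightarrow> (\<Sum>i\<le>d. (-1) ^ i * int (card (B i) * H (d - i))) = 0" by auto
  define p where "p i = int (card (B i))" for i
  have p: "(\<Sum>i\<le>d. (-1) ^ i * (p i * int (H (d - i)))) = 0" if "0 < d" for d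
    using hilbert(2)[OF that] by (simp add: p_def)
  have p0: "p 0 = 1" using hilbert(1) by (simp add: p_def)
  have "{..1::nat} = {0,1}" "{..2::nat} = {0,1,2}" "{..3::nat} = {0,1,2,3}" "{..4::nat} = {0,1,2,3,4}"
    "{..5::nat} = {0,1,2,3,4,5}" "{..6::nat} = {0,1,2,3,4,5,6}" "{..7::nat} = {0,1,2,3,4,5,6,7}"
    by auto
  note expand = this H H(2)[unfolded One_nat_def]
  \<comment> \<open>The equation in degree \<open>d\<close> contains \<open>p d\<close> with
    coefficient \<open>(-1) ^ d\<close>, because \<open>H 0 = 1\<close>; so the earlier ranks
    determine it.\<close>
  have p1: "p 1 = 14" using p[of 1] p0 by (simp add: expand del: One_nat_def)
  have p2: "p 2 = 105" using p[of 2] p0 p1 by (simp add: expand del: One_nat_def)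
  have p3: "p 3 = 560" using p[of 3] p0 p1 p2 by (simp add: expand del: One_nat_def)
  have p4: "p 4 = 2296" using p[of 4] p0 p1 p2 p3 by (simp add: expand del: One_nat_def)
  have p5: "p 5 = 6880" using p[of 5] p0 p1 p2 p3 p4 by (simp add: expand del: One_nat_def)
  have p6: "p 6 = 8904" using p[of 6] p0 p1 p2 p3 p4 p5 by (simp add: expand del: One_nat_def)
  have "p 7 = - 62320" using p[of 7] p0 p1 p2 p3 p4 p5 p6 by (simp add: expand del: One_nat_def)
  then show False by (simp add: p_def)
qed

end
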